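(* Any nilpotent subgroup of $\mathrm{Diff}^2(I)$, $\mathrm{Diff}^2([0,1))$ or $\mathrm{Diff}^2(S^1)$ must be abelian.
   Context: $I=[0,1]$ and $S^1$ is the circle. For $M$ one of $I$, $[0,1)$, $S^1$, $\mathrm{Diff}^2(M)$ denotes the group of orientation-preserving $C^2$ diffeomorphisms of $M$ (differentiability is understood up to and including boundary points of $M$), under composition. *)

theory Defs
  imports "HOL-Analysis.Analysis" "HOL-Algebra.Bij" "HOL-Algebra.Generated_Groups"
begin

section \<open>Nilpotent groups\<close>

primrec lower_central :: "('a, 'b) monoid_scheme \<Rightarrow> nat \<Rightarrow> 'a set" where
  "lower_central G 0 = carrier G"
| "lower_central G (Suc n) = generate G
     (\<Union>x \<in> carrier G. \<Union>y \<in> lower_central G n.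
        {x \<otimes>\<^bsub>G\<^esub> y \<otimes>\<^bsub>G\<^esub> inv\<^bsub>G\<^esub> x \<otimes>\<^bsub>G\<^esub> inv\<^bsub>G\<^esub> y})"

definition nilpotent_group :: "('a, 'b) monoid_scheme \<Rightarrow> bool" where
  "nilpotent_group G \<longleftrightarrow> group G \<and> (\<exists>n. lower_central G n = {\<one>\<^bsub>G\<^esub>})"


section \<open>Groups of C2 diffeomorphisms\<close>

text \<open>Derivatives are taken within \<open>S\<close>, hence one-sided at end points belonging to \<open>S\<close>.
  The notion is meant for sets without isolated points, where derivatives are unique.\<close>

definition C2_on :: "real set \<Rightarrow> (real \<Rightarrow> 'a::real_normed_vector) \<Rightarrow> bool" where
  "C2_on S f \<longleftrightarrow> (\<exists>f' f''.
     (\<forall>t\<in>S. (f has_vector_derivative f' t) (at t within S)) \<and>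
     (\<forall>t\<in>S. (f' has_vector_derivative f'' t) (at t within S)) \<and>
     continuous_on S f'')"

text \<open>As in \<open>BijGroup\<close>, maps are extensional, so that equality of functions is equality on \<open>M\<close>.\<close>

definition Diff2_interval :: "real set \<Rightarrow> (real \<Rightarrow> real) monoid" where
  "Diff2_interval M = (BijGroup M)\<lparr>carrier :=
     {f \<in> Bij M. C2_on M f \<and> C2_on M (inv_into M f) \<and>
        (\<forall>t\<in>M. \<exists>d>0. (f has_vector_derivative d) (at t within M))}\<rparr>"

abbreviation circle :: "complex set" where
  "circle \<equiv> sphere 0 1"

text \<open>The local coordinates of the circle are the local inverses of \<open>cis\<close>. As the circle is
  a submanifold of the plane, a map \<open>f\<close> from it to itself is C2 iff \<open>\<lambda>t. f (cis t)\<close> is C2 as a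
  plane curve. The counterclockwise unit tangent vector at \<open>z\<close> is \<open>\<i> * z\<close>, and \<open>f\<close> preserves
  the orientation iff its differential maps this vector to a positive multiple of
  \<open>\<i> * f z\<close>.\<close>

definition Diff2_circle :: "(complex \<Rightarrow> complex) monoid" where
  "Diff2_circle = (BijGroup circle)\<lparr>carrier :=
     {f \<in> Bij circle. C2_on UNIV (\<lambda>t. f (cis t)) \<and> C2_on UNIV (\<lambda>t. inv_into circle f (cis t)) \<and>
        (\<forall>t. \<exists>d>0. ((\<lambda>s. f (cis s)) has_vector_derivative d *\<^sub>R (\<i> * f (cis t))) (at t))}\<rparr>"


subsection \<open>These are groups\<close>

lemma C2_on_cong:
  assumes "C2_on S f" "\<And>x. x \<in> S \<Longrightarrow> f x = g x"
  shows "C2_on S g"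
proof -
  from assms(1) obtain f' f'' where f:
    "\<forall>t\<in>S. (f has_vector_derivative f' t) (at t within S)"
    "\<forall>t\<in>S. (f' has_vector_derivative f'' t) (at t within S)" "continuous_on S f''"
    unfolding C2_on_def by blast
  have "(g has_vector_derivative f' t) (at t within S)" if "t \<in> S" for t
    by (rule has_vector_derivative_transform[OF that _ f(1)[rule_format, OF that]])
      (simp add: assms(2))
  then show ?thesis unfolding C2_on_def using f by blast
qed

lemma C2_on_compose:
  assumes "C2_on S f" "C2_on T g" "f ` S \<subseteq> T"
  shows "C2_on S (\<lambda>t. g (f t))"
proof -
  from assms(1) obtain f' f'' where f:
    "\<And>t. t \<in> S \<Longrightarrow> (f has_vector_derivative f' t) (at t within S)"
    "\<And>t. t \<in> S \<Longrightarrow> (f' has_vector_derivative f'' t) (at t within S)" "continuous_on S f''"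
    unfolding C2_on_def by blast
  from assms(2) obtain g' g'' where g:
    "\<And>t. t \<in> T \<Longrightarrow> (g has_vector_derivative g' t) (at t within T)"
    "\<And>t. t \<in> T \<Longrightarrow> (g' has_vector_derivative g'' t) (at t within T)" "continuous_on T g''"
    unfolding C2_on_def by blast
  have fT: "f t \<in> T" if "t \<in> S" for t using that assms(3) by blast
  have cf: "continuous_on S f" and cf': "continuous_on S f'"
    using f(1,2) by (meson has_vector_derivative_continuous continuous_on_eq_continuous_within)+
  have cg': "continuous_on T g'"
    using g(2) by (meson has_vector_derivative_continuous continuous_on_eq_continuous_within)
  have d1: "((\<lambda>t. g (f t)) has_vector_derivative f' t *\<^sub>R g' (f t)) (at t within S)"
    if "t \<in> S" for t
    using vector_diff_chain_within[OF f(1)[OF that]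
        has_vector_derivative_within_subset[OF g(1)[OF fT[OF that]] assms(3)]]
    by (simp add: o_def)
  have d2: "((\<lambda>t. g' (f t)) has_vector_derivative f' t *\<^sub>R g'' (f t)) (at t within S)"
    if "t \<in> S" for t
    using vector_diff_chain_within[OF f(1)[OF that]
        has_vector_derivative_within_subset[OF g(2)[OF fT[OF that]] assms(3)]]
    by (simp add: o_def)
  have d3: "((\<lambda>t. f' t *\<^sub>R g' (f t)) has_vector_derivative
      f' t *\<^sub>R (f' t *\<^sub>R g'' (f t)) + f'' t *\<^sub>R g' (f t)) (at t within S)" if "t \<in> S" for t
    using f(2)[OF that] d2[OF that]
    by (intro has_vector_derivative_scaleR)
      (auto simp: has_real_derivative_iff_has_vector_derivative)
  have "continuous_on S (\<lambda>t. f' t *\<^sub>R (f' t *\<^sub>R g'' (f t)) + f'' t *\<^sub>R g' (f t))"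
    using fT by (intro continuous_intros cf cf' f(3)
        continuous_on_compose2[OF cg' cf] continuous_on_compose2[OF g(3) cf]) auto
  with d1 d3 show ?thesis
    unfolding C2_on_def
    by (intro exI[of _ "\<lambda>t. f' t *\<^sub>R g' (f t)"]
        exI[of _ "\<lambda>t. f' t *\<^sub>R (f' t *\<^sub>R g'' (f t)) + f'' t *\<^sub>R g' (f t)"]) auto
qed

lemma C2_on_ident: "C2_on S (\<lambda>x. x)"
  unfolding C2_on_def
  by (intro exI[of _ "\<lambda>_. 1"] exI[of _ "\<lambda>_. 0"]) (auto intro!: derivative_eq_intros)

lemma has_vector_derivative_cis: "(cis has_vector_derivative \<i> * cis t) (at t within S)"
  unfolding has_vector_derivative_def by (rule has_derivative_cis[OF has_derivative_ident])

lemma C2_on_cis: "C2_on S cis"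
  unfolding C2_on_def
  by (intro exI[of _ "\<lambda>t. \<i> * cis t"] exI[of _ "\<lambda>t. \<i> * (\<i> * cis t)"] conjI ballI
      has_vector_derivative_cis has_vector_derivative_mult_right continuous_intros)

lemma Diff2_interval_group:
  assumes "\<And>x. x \<in> M \<Longrightarrow> x islimpt M"
  shows "group (Diff2_interval M)"
proof -
  interpret B: group "BijGroup M" by (rule group_BijGroup)
  let ?D = "carrier (Diff2_interval M)"
  have D: "?D = {f \<in> Bij M. C2_on M f \<and> C2_on M (inv_into M f) \<and>
        (\<forall>t\<in>M. \<exists>d>0. (f has_vector_derivative d) (at t within M))}"
    by (simp add: Diff2_interval_def)
  have "subgroup ?D (BijGroup M)"
  proof (rule B.subgroupI)
    show "?D \<subseteq> carrier (BijGroup M)" by (auto simp: D BijGroup_def)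
    have "(\<lambda>x\<in>M. x) \<in> ?D"
      unfolding D
    proof (intro CollectI conjI ballI)
      show "C2_on M (\<lambda>x\<in>M. x)" by (rule C2_on_cong[OF C2_on_ident]) simp
      show "C2_on M (inv_into M (\<lambda>x\<in>M. x))"
        by (rule C2_on_cong[OF C2_on_ident]) (simp add: inv_into_f_eq inj_on_def)
      show "\<exists>d>0. ((\<lambda>x\<in>M. x) has_vector_derivative d) (at t within M)" if "t \<in> M" for t
        by (intro exI[of _ 1] conjI
            has_vector_derivative_transform[OF that _ has_vector_derivative_id]) auto
    qed (rule id_Bij)
    then show "?D \<noteq> {}" by blast
  next
    fix f assume f: "f \<in> ?D"
    then have fB: "f \<in> Bij M" by (simp add: D)
    then have bij: "bij_betw f M M" by (simp add: Bij_def)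
    let ?g = "\<lambda>x\<in>M. inv_into M f x"
    have gB: "?g \<in> Bij M" by (rule restrict_inv_into_Bij[OF fB])
    have inv: "inv\<^bsub>BijGroup M\<^esub> f = ?g" by (rule inv_BijGroup[OF fB])
    have fg: "f (inv_into M f x) = x" "inv_into M f x \<in> M" if "x \<in> M" for x
      using bij that by (auto simp: bij_betw_def f_inv_into_f inv_into_into)
    have C2g: "C2_on M ?g" by (rule C2_on_cong[of M "inv_into M f"]) (use f in \<open>auto simp: D\<close>)
    have "?g \<in> ?D"
      unfolding D
    proof (intro CollectI conjI ballI gB C2g)
      show "C2_on M (inv_into M ?g)"
      proof (rule C2_on_cong[of M f])
        show "C2_on M f" using f by (simp add: D)
        fix x assume "x \<in> M"
        moreover have "inj_on ?g M" using gB by (auto simp: Bij_def bij_betw_def)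
        moreover have "f x \<in> M" using bij \<open>x \<in> M\<close> by (auto simp: bij_betw_def)
        moreover have "?g (f x) = x"
          using bij \<open>x \<in> M\<close> \<open>f x \<in> M\<close> by (auto simp: bij_betw_def)
        ultimately show "f x = inv_into M ?g x" by (simp add: inv_into_f_eq)
      qed
      fix t assume t: "t \<in> M"
      obtain e where e: "(?g has_vector_derivative e) (at t within M)"
        using C2g t unfolding C2_on_def by blast
      have gt: "?g t \<in> M" using fg(2)[OF t] t by simp
      then obtain d where d: "d > 0" "(f has_vector_derivative d) (at (?g t) within M)"
        using f unfolding D by blast
      have "?g ` M \<subseteq> M" using fg(2) by auto
      from vector_diff_chain_within[OF e has_vector_derivative_within_subset[OF d(2) this]]
      have "((\<lambda>x. x) has_vector_derivative e *\<^sub>R d) (at t within M)"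
        by (rule has_vector_derivative_transform[OF t, rotated]) (simp add: fg)
      moreover have "((\<lambda>x. x) has_vector_derivative 1) (at t within M)"
        by (rule has_vector_derivative_id)
      ultimately have "e * d = 1"
        using assms[OF t] vector_derivative_unique_within[of t M]
        by (metis real_scaleR_def trivial_limit_within)
      then have "e > 0" using d(1) by (metis zero_less_mult_pos2 zero_less_one)
      with e show "\<exists>d>0. (?g has_vector_derivative d) (at t within M)" by blast
    qed
    then show "inv\<^bsub>BijGroup M\<^esub> f \<in> ?D" by (simp only: inv)
  next
    fix f g assume f: "f \<in> ?D" and g: "g \<in> ?D"
    then have fB: "f \<in> Bij M" and gB: "g \<in> Bij M" by (auto simp: D)
    then have bf: "bij_betw f M M" and bg: "bij_betw g M M" by (auto simp: Bij_def)
    have gM: "g x \<in> M" if "x \<in> M" for x using bg that by (auto simp: bij_betw_def)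
    have eq: "f \<otimes>\<^bsub>BijGroup M\<^esub> g = compose M f g" using fB gB by (simp add: BijGroup_def)
    have "compose M f g \<in> ?D"
      unfolding D
    proof (intro CollectI conjI ballI compose_Bij fB gB)
      show "C2_on M (compose M f g)"
        by (rule C2_on_cong[OF C2_on_compose[of M g M f]])
          (use f g gM in \<open>auto simp: D compose_def\<close>)
      show "C2_on M (inv_into M (compose M f g))"
      proof (rule C2_on_cong[OF C2_on_compose[of M "inv_into M f" M "inv_into M g"]])
        show "inv_into M f ` M \<subseteq> M" using bf by (auto simp: bij_betw_def inv_into_into)
        fix x assume x: "x \<in> M"
        let ?y = "inv_into M g (inv_into M f x)"
        have a: "inv_into M f x \<in> M" "f (inv_into M f x) = x"
          using bf x by (auto simp: bij_betw_def inv_into_into f_inv_into_f)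
        have b: "?y \<in> M" "g ?y = inv_into M f x"
          using bg a by (auto simp: bij_betw_def inv_into_into f_inv_into_f)
        have "inj_on (compose M f g) M"
          using compose_Bij[OF fB gB] by (simp add: Bij_def bij_betw_def)
        then show "?y = inv_into M (compose M f g) x"
          using a b by (intro inv_into_f_eq[symmetric]) (auto simp: compose_def)
      qed (use f g in \<open>auto simp: D\<close>)
      fix t assume t: "t \<in> M"
      obtain e where e: "e > 0" "(g has_vector_derivative e) (at t within M)"
        using g t unfolding D by blast
      obtain d where d: "d > 0" "(f has_vector_derivative d) (at (g t) within M)"
        using f gM[OF t] unfolding D by blast
      have "g ` M \<subseteq> M" using gM by blast
      from vector_diff_chain_within[OF e(2) has_vector_derivative_within_subset[OF d(2) this]]
      have "(compose M f g has_vector_derivative e *\<^sub>R d) (at t within M)"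
        by (rule has_vector_derivative_transform[OF t, rotated]) (simp add: compose_def)
      with d(1) e(1) show "\<exists>d>0. (compose M f g has_vector_derivative d) (at t within M)"
        by (metis mult_pos_pos real_scaleR_def)
    qed
    then show "f \<otimes>\<^bsub>BijGroup M\<^esub> g \<in> ?D" by (simp only: eq)
  qed
  from B.subgroup_imp_group[OF this] show ?thesis by (simp add: Diff2_interval_def)
qed

lemma C2_circle_lift:
  fixes G :: "real \<Rightarrow> complex"
  assumes C2: "C2_on UNIV G" and n: "\<And>t. norm (G t) = 1"
  obtains h where "C2_on UNIV h" "\<And>t. G t = cis (h t)"
    "\<And>t d. (G has_vector_derivative d *\<^sub>R (\<i> * G t)) (at t) \<longleftrightarrow> (h has_vector_derivative d) (at t)"
proof -
  from C2 obtain G' G'' where G: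
    "\<And>t. (G has_vector_derivative G' t) (at t)"
    "\<And>t. (G' has_vector_derivative G'' t) (at t)" "continuous_on UNIV G''"
    unfolding C2_on_def by auto
  have G0: "G t \<noteq> 0" for t using n[of t] by auto
  have cG: "continuous_on UNIV G" and cG': "continuous_on UNIV G'"
    using G(1,2) by (meson has_vector_derivative_continuous continuous_on_eq_continuous_within
        has_vector_derivative_at_within)+
  obtain g where g: "continuous_on UNIV g" "\<And>t. G t = exp (g t)"
    using continuous_logarithm_on_contractible[OF cG contractible_UNIV] G0 by auto
  define h where "h = (\<lambda>t. Im (g t))"
  have Re: "Re (g t) = 0" for t using n[of t] by (simp add: g(2))
  have Gh: "G t = cis (h t)" for t
    using Re[of t] by (simp add: g(2) h_def exp_eq_polar)
  have ch: "continuous_on UNIV h" unfolding h_def by (intro continuous_intros g(1))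
  define h' where "h' = (\<lambda>t. Im (G' t / G t))"
  define h'' where "h'' = (\<lambda>t. Im ((G'' t * G t - G' t * G' t) / (G t * G t)))"
  have dh: "(h has_vector_derivative h' t) (at t)" for t
  proof -
    have ev: "\<forall>\<^sub>F s in nhds t. \<bar>h s - h t\<bar> < pi"
    proof -
      have "isCont h t" using ch by (simp add: continuous_on_eq_continuous_at)
      then have "(h \<longlongrightarrow> h t) (nhds t)" by (simp add: continuous_at tendsto_nhds_iff)
      from tendstoD[OF this pi_gt_zero] show ?thesis by (simp add: dist_real_def)
    qed
    have "((\<lambda>s. G s / G t) has_vector_derivative G' t / G t) (at t)"
      by (intro has_vector_derivative_divide G(1))
    moreover have "(Ln has_field_derivative 1) (at (G t / G t))"
      using G0[of t] has_field_derivative_Ln[of 1] by simp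
    ultimately have "((\<lambda>s. Ln (G s / G t)) has_vector_derivative G' t / G t) (at t)"
      using field_vector_diff_chain_at[of "\<lambda>s. G s / G t" "G' t / G t" t Ln 1]
      by (simp add: o_def)
    from has_vector_derivative_add[OF has_vector_derivative_const
        bounded_linear.has_vector_derivative[OF bounded_linear_Im this]]
    have "((\<lambda>s. h t + Im (Ln (G s / G t))) has_vector_derivative h' t) (at t)"
      by (simp add: h'_def)
    moreover have "\<forall>\<^sub>F s in nhds t. h s = h t + Im (Ln (G s / G t))"
      using ev
    proof eventually_elim
      case (elim s)
      have "G s / G t = exp (\<i> * of_real (h s - h t))"
        by (simp add: Gh cis_conv_exp right_diff_distrib exp_diff)
      then have "Ln (G s / G t) = \<i> * of_real (h s - h t)"
        using elim by (simp only:) (intro Ln_exp, auto)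
      then show ?case by simp
    qed
    moreover from this have "h t = h t + Im (Ln (G t / G t))"
      by (rule eventually_nhds_x_imp_x)
    ultimately show ?thesis
      using has_vector_derivative_cong_ev[where x = t and S = UNIV and f = h
          and g = "\<lambda>s. h t + Im (Ln (G s / G t))" and f' = "h' t"]
      by simp
  qed
  have dh': "(h' has_vector_derivative h'' t) (at t)" for t
  proof -
    have "((\<lambda>s. inverse (G s)) has_vector_derivative G' t * - (inverse (G t) * inverse (G t))) (at t)"
      using field_vector_diff_chain_at[OF G(1)[of t] DERIV_inverse[OF G0[of t]]]
      by (simp add: o_def power2_eq_square)
    from has_vector_derivative_mult[OF G(2) this]
    have "((\<lambda>s. G' s / G s) has_vector_derivative
        (G'' t * G t - G' t * G' t) / (G t * G t)) (at t)"
      using G0[of t] by (simp add: field_simps)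
    then show ?thesis unfolding h'_def h''_def
      by (rule bounded_linear.has_vector_derivative[OF bounded_linear_Im])
  qed
  have "continuous_on UNIV h''"
    unfolding h''_def using G0 by (intro continuous_intros cG cG' G(3)) auto
  with dh dh' have C2h: "C2_on UNIV h" unfolding C2_on_def by auto
  have iff: "(G has_vector_derivative d *\<^sub>R (\<i> * G t)) (at t) \<longleftrightarrow> (h has_vector_derivative d) (at t)"
    (is "?L \<longleftrightarrow> ?R") for t d
  proof
    assume ?L
    then have "G' t = d *\<^sub>R (\<i> * G t)" using G(1) vector_derivative_unique_at by blast
    then have "h' t = d" using G0[of t] by (simp add: h'_def scaleR_conv_of_real)
    with dh show ?R by blast
  next
    assume h: ?R
    from vector_diff_chain_at[OF h has_vector_derivative_cis[where S = UNIV]]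
    show ?L by (simp add: Gh[abs_def] o_def)
  qed
  show thesis using that[OF C2h Gh iff] .
qed

lemma Diff2_circle_group: "group Diff2_circle"
proof -
  interpret B: group "BijGroup circle" by (rule group_BijGroup)
  let ?D = "carrier Diff2_circle"
  have D: "?D = {f \<in> Bij circle. C2_on UNIV (\<lambda>t. f (cis t)) \<and>
        C2_on UNIV (\<lambda>t. inv_into circle f (cis t)) \<and>
        (\<forall>t. \<exists>d>0. ((\<lambda>s. f (cis s)) has_vector_derivative d *\<^sub>R (\<i> * f (cis t))) (at t))}"
    by (simp add: Diff2_circle_def)
  have cis: "cis t \<in> circle" for t by simp
  have "subgroup ?D (BijGroup circle)"
  proof (rule B.subgroupI)
    show "?D \<subseteq> carrier (BijGroup circle)" by (auto simp: D BijGroup_def)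
    have inv: "inv_into circle (\<lambda>x\<in>circle. x) (cis t) = cis t" for t
      by (rule inv_into_f_eq) (auto simp: inj_on_def)
    have "(\<lambda>x\<in>circle. x) \<in> ?D"
      unfolding D
    proof (intro CollectI conjI allI)
      show "C2_on UNIV (\<lambda>t. (\<lambda>x\<in>circle. x) (cis t))" by (simp add: C2_on_cis)
      show "C2_on UNIV (\<lambda>t. inv_into circle (\<lambda>x\<in>circle. x) (cis t))"
        by (simp only: inv C2_on_cis)
      show "\<exists>d>0. ((\<lambda>s. (\<lambda>x\<in>circle. x) (cis s)) has_vector_derivative
          d *\<^sub>R (\<i> * (\<lambda>x\<in>circle. x) (cis t))) (at t)" for t
        by (rule exI[of _ 1]) (simp add: has_vector_derivative_cis)
    qed (rule id_Bij)
    then show "?D \<noteq> {}" by blast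
  next
    fix f assume f: "f \<in> ?D"
    then have fB: "f \<in> Bij circle" by (simp add: D)
    then have bij: "bij_betw f circle circle" by (simp add: Bij_def)
    let ?g = "\<lambda>x\<in>circle. inv_into circle f x"
    have gB: "?g \<in> Bij circle" by (rule restrict_inv_into_Bij[OF fB])
    have inv: "inv\<^bsub>BijGroup circle\<^esub> f = ?g" by (rule inv_BijGroup[OF fB])
    have fg: "f (inv_into circle f x) = x" "inv_into circle f x \<in> circle" if "x \<in> circle" for x
      using bij that f_inv_into_f[of x f circle] inv_into_into[of x f circle]
      unfolding bij_betw_def by metis+
    have C2g: "C2_on UNIV (\<lambda>t. ?g (cis t))" using f by (simp add: D)
    have ng: "norm (?g (cis t)) = 1" for t using fg(2)[OF cis] by simp
    obtain h where h: "C2_on UNIV h" "\<And>t. ?g (cis t) = cis (h t)"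
      "\<And>t d. ((\<lambda>t. ?g (cis t)) has_vector_derivative d *\<^sub>R (\<i> * ?g (cis t))) (at t) \<longleftrightarrow>
        (h has_vector_derivative d) (at t)"
      by (rule C2_circle_lift[OF C2g ng]) blast
    have fh: "f (cis (h t)) = cis t" for t
      using fg(1)[OF cis, of t] h(2)[of t] by simp
    have "?g \<in> ?D"
      unfolding D
    proof (intro CollectI conjI allI gB C2g)
      have "inv_into circle ?g x = f x" if x: "x \<in> circle" for x
      proof (rule inv_into_f_eq)
        show "inj_on ?g circle" using gB by (simp add: Bij_def bij_betw_def)
        show "f x \<in> circle" using bij x by (metis bij_betw_apply)
        then show "?g (f x) = x" using bij x by (simp add: bij_betw_def)
      qed
      then show "C2_on UNIV (\<lambda>t. inv_into circle ?g (cis t))"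
        using f by (simp add: D)
      fix t
      obtain e where e: "(h has_vector_derivative e) (at t)"
        using h(1) unfolding C2_on_def by auto
      obtain d where d: "d > 0"
        "((\<lambda>s. f (cis s)) has_vector_derivative d *\<^sub>R (\<i> * f (cis (h t)))) (at (h t))"
        using f unfolding D by blast
      have "(cis has_vector_derivative e *\<^sub>R (d *\<^sub>R (\<i> * cis t))) (at t)"
        using vector_diff_chain_at[OF e d(2)] by (simp add: o_def fh)
      then have "e *\<^sub>R (d *\<^sub>R (\<i> * cis t)) = \<i> * cis t"
        using has_vector_derivative_cis vector_derivative_unique_at by blast
      then have "complex_of_real (e * d) = 1" by (simp add: scaleR_conv_of_real)
      then have "e * d = 1" using of_real_eq_1_iff by blast
      then have "e > 0" using d(1) by (metis zero_less_mult_pos2 zero_less_one)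
      with e show "\<exists>d>0. ((\<lambda>s. ?g (cis s)) has_vector_derivative d *\<^sub>R (\<i> * ?g (cis t))) (at t)"
        using h(3) by blast
    qed
    then show "inv\<^bsub>BijGroup circle\<^esub> f \<in> ?D" by (simp only: inv)
  next
    have comp: "C2_on UNIV (\<lambda>t. f (g (cis t)))"
      if *: "C2_on UNIV (\<lambda>t. f (cis t))" "C2_on UNIV (\<lambda>t. g (cis t))" "\<And>t. norm (g (cis t)) = 1"
      for f g :: "complex \<Rightarrow> complex"
    proof -
      obtain h where "C2_on UNIV h" "\<And>t. g (cis t) = cis (h t)"
        by (rule C2_circle_lift[OF *(2,3)]) blast
      then show ?thesis using C2_on_compose[OF _ *(1), of UNIV h] by simp
    qed
    fix f g assume f: "f \<in> ?D" and g: "g \<in> ?D"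
    then have fB: "f \<in> Bij circle" and gB: "g \<in> Bij circle" by (auto simp: D)
    then have bf: "bij_betw f circle circle" and bg: "bij_betw g circle circle"
      by (auto simp: Bij_def)
    have ng: "norm (g (cis t)) = 1" for t using bij_betw_apply[OF bg cis] by simp
    have eq: "f \<otimes>\<^bsub>BijGroup circle\<^esub> g = compose circle f g"
      using fB gB by (simp add: BijGroup_def)
    have ceq: "compose circle f g (cis t) = f (g (cis t))" for t by (simp add: compose_def)
    have "compose circle f g \<in> ?D"
      unfolding D
    proof (intro CollectI conjI allI compose_Bij fB gB)
      show "C2_on UNIV (\<lambda>t. compose circle f g (cis t))"
        unfolding ceq by (rule comp[of f g]) (use f g ng in \<open>auto simp: D\<close>)
      have inv: "inv_into circle (compose circle f g) x = inv_into circle g (inv_into circle f x)"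
        if x: "x \<in> circle" for x
      proof (rule inv_into_f_eq)
        show "inj_on (compose circle f g) circle"
          using compose_Bij[OF fB gB] by (simp add: Bij_def bij_betw_def)
        have a: "inv_into circle f x \<in> circle" "f (inv_into circle f x) = x"
          using bf x inv_into_into[of x f circle] f_inv_into_f[of x f circle]
          unfolding bij_betw_def by metis+
        show b: "inv_into circle g (inv_into circle f x) \<in> circle"
          using bg a(1) inv_into_into[of _ g circle] unfolding bij_betw_def by metis
        have "g (inv_into circle g (inv_into circle f x)) = inv_into circle f x"
          using bg a(1) f_inv_into_f[of _ g circle] unfolding bij_betw_def by metis
        then show "compose circle f g (inv_into circle g (inv_into circle f x)) = x"
          using a b by (simp add: compose_def)
      qed
      have nf: "norm (inv_into circle f (cis t)) = 1" for t
        using bij_betw_apply[OF bij_betw_inv_into[OF bf] cis] by simp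
      show "C2_on UNIV (\<lambda>t. inv_into circle (compose circle f g) (cis t))"
        unfolding inv[OF cis]
        by (rule comp[of "inv_into circle g" "inv_into circle f"])
          (use f g nf in \<open>auto simp: D\<close>)
      fix t
      have C2g: "C2_on UNIV (\<lambda>t. g (cis t))" using g by (simp add: D)
      obtain h where h: "\<And>t. g (cis t) = cis (h t)"
        "\<And>t d. ((\<lambda>t. g (cis t)) has_vector_derivative d *\<^sub>R (\<i> * g (cis t))) (at t) \<longleftrightarrow>
          (h has_vector_derivative d) (at t)"
        by (rule C2_circle_lift[OF C2g ng]) blast
      obtain e where e: "e > 0" "(h has_vector_derivative e) (at t)"
        using g h(2) unfolding D by blast
      obtain d where d: "d > 0"
        "((\<lambda>s. f (cis s)) has_vector_derivative d *\<^sub>R (\<i> * f (cis (h t)))) (at (h t))"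
        using f unfolding D by blast
      from vector_diff_chain_at[OF e(2) d(2)] d(1) e(1)
      show "\<exists>d>0. ((\<lambda>s. compose circle f g (cis s)) has_vector_derivative
          d *\<^sub>R (\<i> * compose circle f g (cis t))) (at t)"
        unfolding ceq by (intro exI[of _ "e * d"]) (simp add: h(1) o_def)
    qed
    then show "f \<otimes>\<^bsub>BijGroup circle\<^esub> g \<in> ?D" by (simp only: eq)
  qed
  from B.subgroup_imp_group[OF this] show ?thesis by (simp add: Diff2_circle_def)
qed

end

theory Submission
  imports Defs
begin

text \<open>A non-abelian nilpotent group contains \<open>f\<close>, \<open>g\<close> whose commutator \<open>h \<noteq> 1\<close> commutes with
  both. Let \<open>(u, v)\<close> be a component of the complement of the fixed point set of \<open>h\<close> (of a
  lift of \<open>h\<close>, in the case of the circle). Elements commuting with \<open>h\<close> permute these components.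
  If the images of \<open>(u, v)\<close> under the iterates of \<open>f\<close> had bounded total length, then the
  distortion of these iterates would be bounded, which leads to a contradiction as in the proofs of
  the theorems of Kopell and Denjoy. Hence \<open>f\<close> and \<open>g\<close>, or powers of them in the case of the circle,
  fix \<open>u\<close>. But on the right of \<open>u\<close> the map \<open>h\<close> acts like a translation commuting with \<open>f\<close> and
  \<open>g\<close>, so that the commutator of \<open>f\<^sup>n\<close> and \<open>g\<^sup>n\<close> should move points by a linear number of steps
  of \<open>h\<close>, whereas it equals \<open>h\<close> iterated \<open>n\<^sup>2\<close> times.\<close>

section \<open>Central commutators\<close>

lemma (in group) lower_central_subset: "lower_central G n \<subseteq> carrier G"
proof (induction n)
  case (Suc n)
  then show ?case unfolding lower_central.simps by (intro generate_incl) auto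
qed simp

text \<open>The last nontrivial term of the lower central series is central, since the next term is
  trivial. In a non-abelian group it is generated by commutators, and one of these is
  nontrivial.\<close>

lemma (in group) nilpotent_noncommuting_central:
  assumes nil: "nilpotent_group G" and not_comm: "\<not> comm_group G"
  obtains x y c where "x \<in> carrier G" "y \<in> carrier G" "c \<in> carrier G" "c \<noteq> \<one>"
    "x \<otimes> y = c \<otimes> (y \<otimes> x)" "c \<otimes> x = x \<otimes> c" "c \<otimes> y = y \<otimes> c"
proof -
  let ?n = "LEAST n. lower_central G n = {\<one>}"
  have n: "lower_central G ?n = {\<one>}"
    using nil LeastI_ex[of "\<lambda>n. lower_central G n = {\<one>}"] by (auto simp: nilpotent_group_def)
  have eqI: "x \<otimes> y = (x \<otimes> y \<otimes> inv x \<otimes> inv y) \<otimes> (y \<otimes> x)"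
    if "x \<in> carrier G" "y \<in> carrier G" for x y
    using that by (metis inv_closed inv_solve_right m_assoc m_closed)
  have "?n \<noteq> 0"
  proof
    assume "?n = 0"
    then have "carrier G = {\<one>}" using n by simp
    then have "comm_group G" by (intro group_comm_groupI) auto
    with not_comm show False ..
  qed
  then obtain m where m: "?n = Suc m" using not0_implies_Suc by blast
  have ne: "lower_central G m \<noteq> {\<one>}" using not_less_Least[of m "\<lambda>n. lower_central G n = {\<one>}"] m
      by simp
  have central: "x \<otimes> z = z \<otimes> x" if x: "x \<in> carrier G" and z: "z \<in> lower_central G m" for x z
  proof -
    have zG: "z \<in> carrier G" using z lower_central_subset by blast
    have "x \<otimes> z \<otimes> inv x \<otimes> inv z \<in> lower_central G (Suc m)"
      using x z by (auto intro!: generate.incl)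
    then have "x \<otimes> z \<otimes> inv x \<otimes> inv z = \<one>" using n m by simp
    with eqI[OF x zG] x zG show ?thesis by simp
  qed
  \<comment> \<open>Term 0 is the whole group, not a group generated by commutators; it would have
    to be central here.\<close>
  have "m \<noteq> 0"
  proof
    assume "m = 0"
    then have "comm_group G" using central by (intro group_comm_groupI) auto
    with not_comm show False ..
  qed
  then obtain k where k: "m = Suc k" using not0_implies_Suc by blast
  let ?C = "\<Union>x\<in>carrier G. \<Union>y\<in>lower_central G k. {x \<otimes> y \<otimes> inv x \<otimes> inv y}"
  have "\<not> ?C \<subseteq> {\<one>}"
  proof
    assume "?C \<subseteq> {\<one>}"
    from mono_generate[OF this] have "lower_central G m \<subseteq> {\<one>}" using generate_one by (simp add: k)
    moreover have "\<one> \<in> lower_central G m" by (simp add: k generate.one)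
    ultimately show False using ne by blast
  qed
  then obtain x y where x: "x \<in> carrier G" and y: "y \<in> lower_central G k"
    and ne1: "x \<otimes> y \<otimes> inv x \<otimes> inv y \<noteq> \<one>" by auto
  let ?c = "x \<otimes> y \<otimes> inv x \<otimes> inv y"
  have yG: "y \<in> carrier G" using y lower_central_subset by blast
  have "?c \<in> ?C" using x y by blast
  then have "?c \<in> lower_central G m" unfolding k by (auto intro!: generate.incl)
  note c = central[OF _ this]
  show thesis
    by (rule that[OF x yG _ ne1 eqI[OF x yG] c[OF x, symmetric] c[OF yG, symmetric]])
      (use x yG in simp)
qed

text \<open>Most of the dynamics depends on the order alone. Values outside \<open>M\<close> are
  left free, so the notion serves both for extensional maps of an interval and, with
  \<open>M = UNIV\<close>, for lifts of circle maps.\<close>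

definition order_aut :: "'a::linorder set \<Rightarrow> ('a \<Rightarrow> 'a) \<Rightarrow> bool" where
  "order_aut M f \<longleftrightarrow> strict_mono_on M f \<and> f ` M = M"

lemma order_aut_in: "order_aut M f \<Longrightarrow> x \<in> M \<Longrightarrow> f x \<in> M"
  unfolding order_aut_def by blast

lemma order_aut_surj: "order_aut M f \<Longrightarrow> y \<in> M \<Longrightarrow> \<exists>x\<in>M. f x = y"
  unfolding order_aut_def by (metis imageE)

lemma order_aut_less: "order_aut M f \<Longrightarrow> x \<in> M \<Longrightarrow> y \<in> M \<Longrightarrow> f x < f y \<longleftrightarrow> x < y"
  unfolding order_aut_def by (meson strict_mono_on_less)

lemma order_aut_le: "order_aut M f \<Longrightarrow> x \<in> M \<Longrightarrow> y \<in> M \<Longrightarrow> f x \<le> f y \<longleftrightarrow> x \<le> y"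
  unfolding order_aut_def by (meson strict_mono_on_less_eq)

lemma order_aut_eq: "order_aut M f \<Longrightarrow> x \<in> M \<Longrightarrow> y \<in> M \<Longrightarrow> f x = f y \<longleftrightarrow> x = y"
  unfolding order_aut_def by (meson strict_mono_on_eq)

lemma order_aut_inv_into:
  assumes "order_aut M f"
  shows "order_aut M (inv_into M f)"
    and "x \<in> M \<Longrightarrow> f (inv_into M f x) = x" and "x \<in> M \<Longrightarrow> inv_into M f (f x) = x"
proof -
  have b: "bij_betw f M M"
    using assms unfolding order_aut_def bij_betw_def by (auto intro: strict_mono_on_imp_inj_on)
  have 1: "f (inv_into M f x) = x" if "x \<in> M" for x
    using b that by (rule bij_betw_inv_into_right)
  have im: "inv_into M f ` M = M" using b by (rule bij_betw_imp_surj_on[OF bij_betw_inv_into])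
  have "strict_mono_on M (inv_into M f)"
    using order_aut_less[OF assms] im 1 by (intro strict_mono_onI) (metis image_eqI)
  with im show "order_aut M (inv_into M f)" by (simp add: order_aut_def)
  show "x \<in> M \<Longrightarrow> f (inv_into M f x) = x" "x \<in> M \<Longrightarrow> inv_into M f (f x) = x"
    using 1 b by (auto simp: bij_betw_inv_into_left)
qed

lemma order_aut_compose: "order_aut M f \<Longrightarrow> order_aut M g \<Longrightarrow> order_aut M (\<lambda>x. f (g x))"
  unfolding order_aut_def strict_mono_on_def by (simp add: image_image[symmetric]) (metis imageI)

lemma order_aut_funpow: "order_aut M f \<Longrightarrow> order_aut M (f ^^ n)"
proof (induction n)
  case (Suc n)
  then show ?case using order_aut_compose[of M f "f ^^ n"] by (simp add: comp_def)
qed (simp add: order_aut_def strict_mono_on_def)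

section \<open>Iterates and the Heisenberg relation\<close>

lemma funpow_in: "(\<And>x. x \<in> M \<Longrightarrow> f x \<in> M) \<Longrightarrow> x \<in> M \<Longrightarrow> (f ^^ n) x \<in> M"
  by (induction n) auto

lemma funpow_commute_on:
  assumes "\<And>x. x \<in> M \<Longrightarrow> f x \<in> M" "\<And>x. x \<in> M \<Longrightarrow> h x \<in> M"
    and "\<And>x. x \<in> M \<Longrightarrow> h (f x) = f (h x)" and "x \<in> M"
  shows "(h ^^ k) ((f ^^ n) x) = (f ^^ n) ((h ^^ k) x)"
proof -
  have 1: "h ((f ^^ n) x) = (f ^^ n) (h x)" if "x \<in> M" for x
    using that by (induction n) (auto simp: assms funpow_in)
  show ?thesis by (induction k) (auto simp: 1 assms funpow_in)
qed

text \<open>Moving one \<open>f\<close> past \<open>g ^^ m\<close> releases \<open>m\<close> copies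
  of \<open>h\<close>, which commute with everything; moving \<open>n\<close> of them releases
  \<open>n * m\<close>.\<close>

lemma funpow_commutator_on:
  assumes in_M: "\<And>x. x \<in> M \<Longrightarrow> f x \<in> M" "\<And>x. x \<in> M \<Longrightarrow> g x \<in> M" "\<And>x. x \<in> M \<Longrightarrow> h x \<in> M"
    and fg: "\<And>x. x \<in> M \<Longrightarrow> f (g x) = h (g (f x))"
    and hf: "\<And>x. x \<in> M \<Longrightarrow> h (f x) = f (h x)" and hg: "\<And>x. x \<in> M \<Longrightarrow> h (g x) = g (h x)"
    and "x \<in> M"
  shows "(f ^^ n) ((g ^^ m) x) = (h ^^ (n * m)) ((g ^^ m) ((f ^^ n) x))"
proof -
  note hgm = funpow_commute_on[of M g h, OF in_M(2,3) hg]
      and hfn = funpow_commute_on[of M f h, OF in_M(1,3) hf]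
  have 1: "f ((g ^^ m) x) = (h ^^ m) ((g ^^ m) (f x))" if x: "x \<in> M" for x
  proof (induction m)
    case (Suc m)
    have "f ((g ^^ Suc m) x) = h (g ((h ^^ m) ((g ^^ m) (f x))))"
      using Suc x by (simp add: fg in_M funpow_in)
    also have "g ((h ^^ m) ((g ^^ m) (f x))) = (h ^^ m) (g ((g ^^ m) (f x)))"
      using hgm[of "(g ^^ m) (f x)" m 1] x by (simp add: in_M funpow_in)
    finally show ?case by simp
  qed simp
  show ?thesis
  proof (induction n)
    case (Suc n)
    have "(f ^^ Suc n) ((g ^^ m) x) = f ((h ^^ (n * m)) ((g ^^ m) ((f ^^ n) x)))" using Suc by simp
    also have "\<dots> = (h ^^ (n * m)) (f ((g ^^ m) ((f ^^ n) x)))"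
      using hfn[of "(g ^^ m) ((f ^^ n) x)" "n * m" 1] \<open>x \<in> M\<close> by (simp add: in_M funpow_in)
    also have "\<dots> = (h ^^ (n * m)) ((h ^^ m) ((g ^^ m) (f ((f ^^ n) x))))"
      using \<open>x \<in> M\<close> by (simp add: 1 in_M funpow_in)
    also have "\<dots> = (h ^^ (Suc n * m)) ((g ^^ m) ((f ^^ Suc n) x))"
      by (simp add: funpow_add add.commute[of m])
    finally show ?case .
  qed simp
qed

lemma order_aut_funpow_less:
  assumes f: "order_aut M f" and x: "x \<in> M" "f x < x" and mn: "m < n"
  shows "(f ^^ n) x < (f ^^ m) x"
  using mn
proof (rule less_Suc_induct)
  fix i
  show "(f ^^ Suc i) x < (f ^^ i) x"
    using order_aut_less[OF order_aut_funpow[OF f, of i], of "f x" x] x order_aut_in[OF f]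
    by (simp add: funpow_swap1)
qed simp

text \<open>The commutator of \<open>f\<^sup>n\<close> and \<open>g\<^sup>n\<close> is \<open>h\<close> iterated \<open>n\<^sup>2\<close> times, whereas the
  bounds on \<open>f\<close> and \<open>g\<close> only allow for linearly many iterations of \<open>h\<close>.\<close>

lemma central_commutator_not_archimedean:
  assumes f: "order_aut M f" and g: "order_aut M g" and h: "order_aut M h"
    and fg: "\<And>x. x \<in> M \<Longrightarrow> f (g x) = h (g (f x))"
    and hf: "\<And>x. x \<in> M \<Longrightarrow> h (f x) = f (h x)" and hg: "\<And>x. x \<in> M \<Longrightarrow> h (g x) = g (h x)"
    and x: "x \<in> M" "h x < x"
    and kf: "(h ^^ k) x \<le> f x" "(h ^^ k) (f x) \<le> x"
    and kg: "(h ^^ k) x \<le> g x" "(h ^^ k) (g x) \<le> x"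
  shows False
proof -
  note [simp] = order_aut_in[OF f] order_aut_in[OF g] order_aut_in[OF h]
    order_aut_in[OF order_aut_funpow[OF f]] order_aut_in[OF order_aut_funpow[OF g]]
    order_aut_in[OF order_aut_funpow[OF h]] order_aut_le[OF order_aut_funpow[OF f]]
    order_aut_le[OF order_aut_funpow[OF g]] order_aut_le[OF order_aut_funpow[OF h]] \<open>x \<in> M\<close>
  \<comment> \<open>As \<open>p\<close> commutes with \<open>h\<close>, the cost of \<open>k\<close>
    steps of \<open>h\<close> for one application of \<open>p\<close> adds up to
    \<open>k * n\<close> steps for \<open>n\<close> applications.\<close>
  have bounds: "(h ^^ (k * n)) ((p ^^ n) x) \<le> x" "(h ^^ (k * n)) x \<le> (p ^^ n) x"
    if p: "order_aut M p" and hp: "\<And>x. x \<in> M \<Longrightarrow> h (p x) = p (h x)"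
      and kp: "(h ^^ k) x \<le> p x" "(h ^^ k) (p x) \<le> x" for p n
  proof -
    note [simp] = order_aut_in[OF p] order_aut_in[OF order_aut_funpow[OF p]]
      order_aut_le[OF p] order_aut_le[OF order_aut_funpow[OF p]]
    have comm: "(h ^^ i) ((p ^^ j) y) = (p ^^ j) ((h ^^ i) y)" if "y \<in> M" for i j y
      by (rule funpow_commute_on[of M]) (use hp that in auto)
    show "(h ^^ (k * n)) ((p ^^ n) x) \<le> x"
    proof (induction n)
      case (Suc n)
      have "(h ^^ (k * Suc n)) ((p ^^ Suc n) x) = (h ^^ k) ((h ^^ (k * n)) (p ((p ^^ n) x)))"
        by (simp add: funpow_add)
      also have "(h ^^ (k * n)) (p ((p ^^ n) x)) = p ((h ^^ (k * n)) ((p ^^ n) x))"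
        using comm[of "(p ^^ n) x" "k * n" 1] by simp
      also have "(h ^^ k) (p ((h ^^ (k * n)) ((p ^^ n) x))) \<le> (h ^^ k) (p x)" using Suc by simp
      also have "\<dots> \<le> x" by (rule kp(2))
      finally show ?case .
    qed simp
    show "(h ^^ (k * n)) x \<le> (p ^^ n) x"
    proof (induction n)
      case (Suc n)
      have "(h ^^ (k * Suc n)) x = (h ^^ k) ((h ^^ (k * n)) x)" by (simp add: funpow_add)
      also have "\<dots> \<le> (h ^^ k) ((p ^^ n) x)" using Suc by simp
      also have "\<dots> = (p ^^ n) ((h ^^ k) x)" by (rule comm) simp
      also have "\<dots> \<le> (p ^^ n) (p x)" using kp(1) by simp
      finally show ?case by (simp add: funpow_swap1)
    qed simp
  qed
  note bf = bounds[OF f hf kf] and bg = bounds[OF g hg kg]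
  have hfc: "(h ^^ i) ((f ^^ j) y) = (f ^^ j) ((h ^^ i) y)" if "y \<in> M" for i j y
    by (rule funpow_commute_on[of M]) (use hf that in auto)
  have hgc: "(h ^^ i) ((g ^^ j) y) = (g ^^ j) ((h ^^ i) y)" if "y \<in> M" for i j y
    by (rule funpow_commute_on[of M]) (use hg that in auto)
  \<comment> \<open>The estimates on \<open>f ^^ n\<close> and \<open>g ^^ n\<close>, used once from
    each side, cost \<open>4 * k * n\<close> steps of \<open>h\<close>. This choice makes
    \<open>n * n\<close> exceed that cost by \<open>n > 0\<close>.\<close>
  define n where "n = 4 * k + 1"
  let ?a = "k * n"
  have sq: "n * n = (?a + ?a + n) + (?a + ?a)" by (simp add: n_def algebra_simps)
  have "(h ^^ (?a + ?a)) ((g ^^ n) ((f ^^ n) x)) = (h ^^ ?a) ((g ^^ n) ((h ^^ ?a) ((f ^^ n) x)))"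
    by (simp add: funpow_add hgc)
  also have "\<dots> \<le> (h ^^ ?a) ((g ^^ n) x)" using bf by simp
  also have "\<dots> \<le> x" by (rule bg)
  finally have le: "(h ^^ (?a + ?a)) ((g ^^ n) ((f ^^ n) x)) \<le> x" .
  have "(h ^^ (?a + ?a)) x = (h ^^ ?a) ((h ^^ ?a) x)" by (simp add: funpow_add)
  also have "\<dots> \<le> (h ^^ ?a) ((f ^^ n) x)" using bf by simp
  also have "\<dots> = (f ^^ n) ((h ^^ ?a) x)" by (simp add: hfc)
  also have "\<dots> \<le> (f ^^ n) ((g ^^ n) x)" using bg by simp
  also have "\<dots> = (h ^^ (n * n)) ((g ^^ n) ((f ^^ n) x))"
    by (rule funpow_commutator_on[of M]) (use fg hf hg in auto)
  also have "\<dots> = (h ^^ (?a + ?a + n)) ((h ^^ (?a + ?a)) ((g ^^ n) ((f ^^ n) x)))"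
    unfolding sq funpow_add by simp
  also have "\<dots> \<le> (h ^^ (?a + ?a + n)) x" using le by simp
  also have "\<dots> < (h ^^ (?a + ?a)) x"
    by (rule order_aut_funpow_less[OF h x]) (simp add: n_def)
  finally show False by simp
qed

text \<open>The Archimedean property yields one exponent for each of the four bounds. Since
  \<open>h\<close> lowers the points of \<open>D\<close>, iterating further keeps a bound true, so
  the sum of the exponents serves for all four.\<close>

lemma central_commutator_not_archimedean_on:
  assumes f: "order_aut M f" and g: "order_aut M g" and h: "order_aut M h"
    and fg: "\<And>x. x \<in> M \<Longrightarrow> f (g x) = h (g (f x))"
    and hf: "\<And>x. x \<in> M \<Longrightarrow> h (f x) = f (h x)" and hg: "\<And>x. x \<in> M \<Longrightarrow> h (g x) = g (h x)"
    and D: "D \<subseteq> M" "x \<in> D" "f x \<in> D" "g x \<in> D" "\<And>y. y \<in> D \<Longrightarrow> h y < y"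
    and arch: "\<And>y z. y \<in> D \<Longrightarrow> z \<in> D \<Longrightarrow> \<exists>k. (h ^^ k) y \<le> z"
  shows False
proof -
  have mono: "(h ^^ n) y \<le> z" if "(h ^^ k) y \<le> z" "k \<le> n" "y \<in> D" for k n y z
  proof (cases "k = n")
    case False
    then have "(h ^^ n) y < (h ^^ k) y"
      using that D(1,5) by (intro order_aut_funpow_less[OF h]) auto
    with that(1) show ?thesis by simp
  qed (use that in simp)
  obtain a b c d where k: "(h ^^ a) x \<le> f x" "(h ^^ b) (f x) \<le> x" "(h ^^ c) x \<le> g x"
      "(h ^^ d) (g x) \<le> x"
    using arch D by metis
  let ?k = "a + b + c + d"
  show False
  proof (rule central_commutator_not_archimedean[OF f g h])
    show "x \<in> M" "h x < x" using D by auto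
    show "(h ^^ ?k) x \<le> f x" by (rule mono[OF k(1)]) (use D in auto)
    show "(h ^^ ?k) (f x) \<le> x" by (rule mono[OF k(2)]) (use D in auto)
    show "(h ^^ ?k) x \<le> g x" by (rule mono[OF k(3)]) (use D in auto)
    show "(h ^^ ?k) (g x) \<le> x" by (rule mono[OF k(4)]) (use D in auto)
  qed (fact fg hf hg)+
qed

text \<open>The infimum of the orbit of \<open>y\<close> is the fixed point. Monotonicity gives
  \<open>h (Inf ?A) \<le> Inf ?A\<close>; for the converse, the preimage \<open>l\<close> of the
  infimum is itself a lower bound of the orbit.\<close>

lemma order_aut_fixed_point_or_below:
  fixes M :: "'a::conditionally_complete_linorder set"
  assumes h: "order_aut M h" and M: "{z..y} \<subseteq> M" "z \<le> y" and hy: "h y \<le> y"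
    and above: "\<And>k. z \<le> (h ^^ k) y"
  obtains x where "z \<le> x" "x \<le> y" "h x = x"
proof -
  have yM: "y \<in> M" using M by auto
  let ?A = "range (\<lambda>k. (h ^^ k) y)"
  have bdd: "bdd_below ?A" using above by (intro bdd_belowI2[of _ z])
  have L: "z \<le> Inf ?A" "Inf ?A \<le> y"
    using above cINF_lower[OF bdd, of 0] by (auto intro: cINF_greatest)
  then have LM: "Inf ?A \<in> M" using M(1) by (meson atLeastAtMost_iff subsetD)
  obtain l where l: "l \<in> M" "h l = Inf ?A" using order_aut_surj[OF h LM] by blast
  have lower: "Inf ?A \<le> (h ^^ k) y" for k by (rule cINF_lower[OF bdd]) simp
  have "l \<le> Inf ?A"
  proof (rule cINF_greatest)
    fix k
    show "l \<le> (h ^^ k) y"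
      using lower[of "Suc k"] order_aut_le[OF h l(1), of "(h ^^ k) y"]
        order_aut_in[OF order_aut_funpow[OF h] yM, of k]
            unfolding funpow.simps o_apply l(2)[symmetric] by blast
  qed simp
  moreover have "h (Inf ?A) \<le> Inf ?A"
  proof (rule cINF_greatest)
    fix k
    show "h (Inf ?A) \<le> (h ^^ k) y"
    proof (cases k)
      case 0
      then show ?thesis using order_aut_le[OF h LM yM] L(2) hy by simp
    next
      case (Suc j)
      then show ?thesis
        using lower[of j] order_aut_le[OF h LM, of "(h ^^ j) y"]
          order_aut_in[OF order_aut_funpow[OF h] yM, of j] by simp
    qed
  qed simp
  ultimately have "h (Inf ?A) = Inf ?A"
    using order_aut_le[OF h l(1) LM] l(2) by (metis order_antisym)
  then show thesis by (rule that[OF L])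
qed

section \<open>Fixed points of central commutators on intervals\<close>

lemma is_interval_Icc_subset: "is_interval S \<Longrightarrow> x \<in> S \<Longrightarrow> y \<in> S \<Longrightarrow> {x..y} \<subseteq> S" for S :: "real set"
  unfolding is_interval_1 by (meson atLeastAtMost_iff subsetI)

text \<open>If \<open>h\<close> has no fixed point in \<open>D\<close>, it moves all of
  \<open>D\<close> in one direction. Its orbits then pass every point of \<open>D\<close>, as they
  would otherwise converge to a fixed point, and this is the Archimedean situation already
  excluded.\<close>

lemma central_commutator_fixed_point:
  fixes M :: "real set"
  assumes f: "order_aut M f" and g: "order_aut M g" and h: "order_aut M h"
    and fg: "\<And>x. x \<in> M \<Longrightarrow> f (g x) = h (g (f x))"
    and hf: "\<And>x. x \<in> M \<Longrightarrow> h (f x) = f (h x)" and hg: "\<And>x. x \<in> M \<Longrightarrow> h (g x) = g (h x)"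
    and DM: "D \<subseteq> M" and ivl: "is_interval D" and cont: "continuous_on D h"
    and p: "p \<in> D" "f p \<in> D" "g p \<in> D"
  shows "\<exists>x\<in>D. h x = x"
proof (rule ccontr)
  assume "\<not> ?thesis"
  then have nofix: "h x \<noteq> x" if "x \<in> D" for x using that by blast
  \<comment> \<open>Stated for arbitrary maps because it is applied twice: to \<open>f\<close>,
    \<open>g\<close>, \<open>h\<close> if \<open>h\<close> moves points down, and to
    \<open>g\<close>, \<open>f\<close> and the inverse of \<open>h\<close> if it moves them
    up.\<close>
  have key: False
    if f: "order_aut M f" and g: "order_aut M g" and k: "order_aut M k"
      and fg: "\<And>x. x \<in> M \<Longrightarrow> f (g x) = k (g (f x))"
      and kf: "\<And>x. x \<in> M \<Longrightarrow> k (f x) = f (k x)" and kg: "\<And>x. x \<in> M \<Longrightarrow> k (g x) = g (k x)"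
      and fgD: "f p \<in> D" "g p \<in> D" and less: "\<And>x. x \<in> D \<Longrightarrow> k x < x" for f g k
  proof (rule central_commutator_not_archimedean_on[OF f g k])
    fix y z assume y: "y \<in> D" and z: "z \<in> D"
    have zyD: "{z..y} \<subseteq> D" by (rule is_interval_Icc_subset[OF ivl z y])
    show "\<exists>n. (k ^^ n) y \<le> z"
    proof (rule ccontr)
      assume "\<nexists>n. (k ^^ n) y \<le> z"
      then have above: "z \<le> (k ^^ n) y" for n using linear by blast
      have zy: "z \<le> y" using above[of 0] by simp
      obtain x where x: "z \<le> x" "x \<le> y" "k x = x"
        using order_aut_fixed_point_or_below[OF k order_trans[OF zyD DM] zy less_imp_le[OF less[OF
            y]] above]
        by blast
      then have "x \<in> D" using zyD by auto
      with less x show False by fastforce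
    qed
  qed (use fg kf kg fgD DM less p in auto)
  have "connected ((\<lambda>x. h x - x) ` D)"
    using ivl cont by (intro connected_continuous_image continuous_intros)
      (simp_all add: is_interval_connected_1)
  then have iv: "is_interval ((\<lambda>x. h x - x) ` D)" by (simp add: is_interval_connected_1)
  have ne: "0 \<notin> (\<lambda>x. h x - x) ` D" using nofix by auto
  consider "\<And>x. x \<in> D \<Longrightarrow> h x < x" | "\<And>x. x \<in> D \<Longrightarrow> x < h x"
  proof -
    have "(\<forall>x\<in>D. h x < x) \<or> (\<forall>x\<in>D. x < h x)"
    proof (rule ccontr)
      assume "\<not> ?thesis"
      then obtain a b where "a \<in> D" "b \<in> D" "h a - a \<le> 0" "0 \<le> h b - b" using not_less by auto
      then have "0 \<in> (\<lambda>x. h x - x) ` D" using iv unfolding is_interval_1 by blast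
      with ne show False ..
    qed
    with that show thesis by blast
  qed
  then show False
  proof cases
    case 1
    show ?thesis
      by (rule key[of f g h]) (fact f g h fg hf hg p(2,3) 1)+
  next
    case 2
    let ?k = "inv_into M h"
    note k = order_aut_inv_into[OF h]
    note kM = order_aut_in[OF k(1)]
    have comm: "?k (e x) = e (?k x)" if e: "order_aut M e" and he: "\<And>x. x \<in> M \<Longrightarrow> h (e x) = e (h x)"
        and x: "x \<in> M" for e x
      using he[OF kM[OF x]] k(2)[OF x] k(3)[OF order_aut_in[OF e kM[OF x]]] by simp
    show ?thesis
    proof (rule key[OF g f k(1)])
      show "g (f x) = ?k (f (g x))" if "x \<in> M" for x
        using fg[OF that] k(3) order_aut_in[OF f] order_aut_in[OF g] that by simp
      show "?k x < x" if "x \<in> D" for x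
        using 2[OF that] order_aut_less[OF h kM, of x x] k(2)[of x] that DM by auto
      show "?k (g x) = g (?k x)" "?k (f x) = f (?k x)" if "x \<in> M" for x
        using comm f g hf hg that by blast+
    qed (use p in blast)+
  qed
qed

text \<open>Maps that fix \<open>u\<close> and commute with \<open>h\<close> preserve the stretch
  from \<open>u\<close> to the next fixed point of \<open>h\<close>. On that stretch a central
  commutator would need a fixed point.\<close>

lemma germ_not_archimedean:
  fixes M :: "real set"
  assumes ivl: "is_interval M"
    and f: "order_aut M f" and g: "order_aut M g" and h: "order_aut M h"
    and fg: "\<And>x. x \<in> M \<Longrightarrow> f (g x) = h (g (f x))"
    and hf: "\<And>x. x \<in> M \<Longrightarrow> h (f x) = f (h x)" and hg: "\<And>x. x \<in> M \<Longrightarrow> h (g x) = g (h x)"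
    and cont: "continuous_on M h"
    and u: "u \<in> M" "f u = u" "g u = u" and p: "p \<in> M" "u < p"
    and nofix: "\<And>x. u < x \<Longrightarrow> x \<le> p \<Longrightarrow> h x \<noteq> x"
  shows False
proof -
  note M = is_interval_Icc_subset[OF ivl]
  \<comment> \<open>This is the part of \<open>M\<close> to the right of \<open>u\<close> and before
    the next fixed point of \<open>h\<close>, if there is one.\<close>
  define D where "D = {x \<in> M. u < x \<and> (\<forall>y. u < y \<and> y \<le> x \<longrightarrow> h y \<noteq> y)}"
  have DM: "D \<subseteq> M" by (auto simp: D_def)
  have pD: "p \<in> D" using p nofix by (auto simp: D_def)
  have inv: "e p \<in> D" if e: "order_aut M e" and he: "\<And>x. x \<in> M \<Longrightarrow> h (e x) = e (h x)"
      and eu: "e u = u" for e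
  proof -
    have "h y \<noteq> y" if y: "u < y" "y \<le> e p" for y
    proof -
      have "y \<in> M" using subsetD[OF M[OF u(1) order_aut_in[OF e p(1)]], of y] y by simp
      then obtain z where z: "z \<in> M" "y = e z" using order_aut_surj[OF e] by blast
      have "u < z" "z \<le> p"
        using y z order_aut_less[OF e u(1) z(1)] order_aut_le[OF e z(1) p(1)] eu by auto
      then have "h z \<noteq> z" by (rule nofix)
      then show ?thesis
        using order_aut_eq[OF e order_aut_in[OF h z(1)] z(1)] he[OF z(1)] z(2) by simp
    qed
    moreover have "u < e p" using order_aut_less[OF e u(1) p(1)] eu p(2) by simp
    ultimately show ?thesis using order_aut_in[OF e p(1)] by (auto simp: D_def)
  qed
  have "is_interval D"
    unfolding is_interval_1
  proof (intro ballI allI impI)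
    fix x y z assume xz: "x \<in> D" "y \<in> D" "x \<le> z \<and> z \<le> y"
    then have "z \<in> M" using subsetD[OF M, of x y z] DM by auto
    with xz show "z \<in> D" by (auto simp: D_def)
  qed
  then obtain x where "x \<in> D" "h x = x"
    using central_commutator_fixed_point[OF f g h _ _ _ DM _ continuous_on_subset[OF cont DM] pD
        inv[OF f hf u(2)] inv[OF g hg u(3)]] fg hf hg by blast
  then show False by (auto simp: D_def)
qed

section \<open>Wandering intervals\<close>

text \<open>The chain rule with the product written as the exponential of a sum of logarithms, so
  that distortion becomes a difference of such sums.\<close>

lemma funpow_has_real_derivative:
  assumes S: "\<And>x. x \<in> S \<Longrightarrow> F x \<in> S"
    and F: "\<And>x. x \<in> S \<Longrightarrow> (F has_real_derivative F' x) (at x within S)"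
    and pos: "\<And>x. x \<in> S \<Longrightarrow> F' x > 0" and "x \<in> S"
  shows "((F ^^ n) has_real_derivative exp (\<Sum>i<n. ln (F' ((F ^^ i) x)))) (at x within S)"
proof (induction n)
  case (Suc n)
  have xn: "(F ^^ n) x \<in> S" by (rule funpow_in[OF S \<open>x \<in> S\<close>])
  have "(F ^^ n) ` S \<subseteq> S" using funpow_in[of S F] S by blast
  then have "(F has_real_derivative F' ((F ^^ n) x)) (at ((F ^^ n) x) within (F ^^ n) ` S)"
    by (rule DERIV_subset[OF F[OF xn]])
  from DERIV_image_chain[OF this Suc] show ?case
    using pos[OF xn] by (simp add: comp_def exp_add mult.commute)
qed (simp add: id_def)

text \<open>The derivatives of the iterates of \<open>H\<close> on \<open>(u, v)\<close> are compared with those on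
  \<open>F\<^sup>n (u, v)\<close>, where they are close to 1 because the end points are fixed.
  As the intervals \<open>F\<^sup>n (u, v)\<close> have bounded total length, \<open>F\<^sup>n\<close> has bounded distortion.
  Hence the derivatives of the iterates of \<open>H\<close> are bounded away from 0 on \<open>(u, v)\<close>, which
  cannot be as the orbits of \<open>H\<close> converge.\<close>

lemma no_wandering_interval:
  fixes S :: "real set" and F H F' H' :: "real \<Rightarrow> real"
  assumes ivl: "is_interval S"
    and FS: "\<And>x. x \<in> S \<Longrightarrow> F x \<in> S" and HS: "\<And>x. x \<in> S \<Longrightarrow> H x \<in> S"
    and monoF: "strict_mono_on S F" and monoH: "strict_mono_on S H"
    and F: "\<And>x. x \<in> S \<Longrightarrow> (F has_real_derivative F' x) (at x within S)" "\<And>x. x \<in> S \<Longrightarrow> F' x > 0"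
    and H: "\<And>x. x \<in> S \<Longrightarrow> (H has_real_derivative H' x) (at x within S)" "\<And>x. x \<in> S \<Longrightarrow> H' x > 0"
    and L: "\<And>x y. x \<in> S \<Longrightarrow> y \<in> S \<Longrightarrow> \<bar>ln (F' x) - ln (F' y)\<bar> \<le> L * \<bar>x - y\<bar>" "0 \<le> L"
    and K: "\<And>x y. x \<in> S \<Longrightarrow> y \<in> S \<Longrightarrow> \<bar>ln (H' x) - ln (H' y)\<bar> \<le> K * \<bar>x - y\<bar>" "0 \<le> K"
    and HF: "\<And>x. x \<in> S \<Longrightarrow> H (F x) = F (H x)"
    and u: "u \<in> S" "H u = u" and v: "v \<in> S" "H v = v" and uv: "u < v"
    and nofix: "\<And>x. u < x \<Longrightarrow> x < v \<Longrightarrow> H x \<noteq> x"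
    and B: "\<And>n. (\<Sum>i<n. (F ^^ i) v - (F ^^ i) u) \<le> B"
  shows False
proof -
  note S = is_interval_Icc_subset[OF ivl]
  \<comment> \<open>\<open>\<phi> n\<close> and \<open>\<psi> n\<close> are the logarithms of the
    derivatives of \<open>F ^^ n\<close> and \<open>H ^^ n\<close>.\<close>
  define \<phi> where "\<phi> n x = (\<Sum>i<n. ln (F' ((F ^^ i) x)))" for n x
  define \<psi> where "\<psi> n x = (\<Sum>i<n. ln (H' ((H ^^ i) x)))" for n x
  have FnS: "(F ^^ n) x \<in> S" and HnS: "(H ^^ n) x \<in> S" if "x \<in> S" for n x
    using that by (auto intro: funpow_in FS HS)
  have J: "x \<in> S" if "x \<in> {u..v}" for x using S[OF u(1) v(1)] that by blast
  have monoFn: "(F ^^ n) x < (F ^^ n) y" if "x \<in> S" "y \<in> S" "x < y" for n x y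
    using that by (induction n) (auto intro: strict_mono_onD[OF monoF] FnS)
  have monoHn: "(H ^^ n) x < (H ^^ n) y" if "x \<in> S" "y \<in> S" "x < y" for n x y
    using that by (induction n) (auto intro: strict_mono_onD[OF monoH] HnS)
  have monoFn': "(F ^^ n) x \<le> (F ^^ n) y" if "x \<in> S" "y \<in> S" "x \<le> y" for n x y
    using monoFn[of x y n] that by (cases "x = y") auto
  have monoHn': "(H ^^ n) x \<le> (H ^^ n) y" if "x \<in> S" "y \<in> S" "x \<le> y" for n x y
    using monoHn[of x y n] that by (cases "x = y") auto
  have dF: "((F ^^ n) has_real_derivative exp (\<phi> n x)) (at x within S)" if "x \<in> S" for n x
    unfolding \<phi>_def by (rule funpow_has_real_derivative[OF FS F that])
  have dH: "((H ^^ n) has_real_derivative exp (\<psi> n x)) (at x within S)" if "x \<in> S" for n x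
    unfolding \<psi>_def by (rule funpow_has_real_derivative[OF HS H that])
  have at: "at x within S = at x" if "a \<in> S" "b \<in> S" "a < x" "x < b" for a b x
    using S[OF that(1,2)] that by (intro at_within_open_subset[of x "{a<..<b}"]) auto
  have comm: "(H ^^ m) ((F ^^ n) x) = (F ^^ n) ((H ^^ m) x)" if "x \<in> S" for m n x
    by (rule funpow_commute_on[of S]) (use FS HS HF that in auto)
  have Hfix: "(H ^^ m) a = a" if "H a = a" for m a using that by (induction m) auto
  have mvt: "\<exists>\<xi>>a. \<xi> < b \<and> (H ^^ m) b - (H ^^ m) a = (b - a) * exp (\<psi> m \<xi>)"
    if ab: "a \<in> S" "b \<in> S" "a < b" for a b m
  proof -
    have "continuous_on {a..b} (H ^^ m)"
      using DERIV_subset[OF dH S[OF ab(1,2)]] S[OF ab(1,2)]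
      by (intro DERIV_continuous_on[where D = "\<lambda>x. exp (\<psi> m x)"]) blast
    moreover have "((H ^^ m) has_real_derivative exp (\<psi> m x)) (at x)" if "a < x" "x < b" for x
      using dH[of x m] at[OF ab(1,2) that] subsetD[OF S[OF ab(1,2)], of x] that by auto
    ultimately show ?thesis
      using MVT[of a b "H ^^ m"] ab(3)
      by (metis DERIV_unique real_differentiable_def)
  qed
  \<comment> \<open>The \<open>i\<close>-th terms differ by at most \<open>L\<close> times the
    length of the \<open>i\<close>-th image of \<open>(u, v)\<close>, and these lengths sum to at
    most \<open>B\<close>, whatever \<open>n\<close> is.\<close>
  have distF: "\<bar>\<phi> n x - \<phi> n y\<bar> \<le> L * B" if xy: "x \<in> {u..v}" "y \<in> {u..v}" for n x y
  proof -
    have "\<bar>\<phi> n x - \<phi> n y\<bar> \<le> (\<Sum>i<n. \<bar>ln (F' ((F ^^ i) x)) - ln (F' ((F ^^ i) y))\<bar>)"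
      unfolding \<phi>_def sum_subtractf[symmetric] by (rule sum_abs)
    also have "\<dots> \<le> (\<Sum>i<n. L * ((F ^^ i) v - (F ^^ i) u))"
    proof (rule sum_mono)
      fix i
      have "\<bar>(F ^^ i) x - (F ^^ i) y\<bar> \<le> (F ^^ i) v - (F ^^ i) u"
        using monoFn'[of u x i] monoFn'[of u y i] monoFn'[of x v i] monoFn'[of y v i] xy J u v
        by auto
      then show "\<bar>ln (F' ((F ^^ i) x)) - ln (F' ((F ^^ i) y))\<bar> \<le> L * ((F ^^ i) v - (F ^^ i) u)"
        using L(1)[of "(F ^^ i) x" "(F ^^ i) y"] L(2) xy J FnS by (meson mult_left_mono order_trans)
    qed
    also have "\<dots> \<le> L * B" using B L(2) by (simp add: sum_distrib_left[symmetric] mult_left_mono)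
    finally show ?thesis .
  qed
  \<comment> \<open>As \<open>H ^^ m\<close> fixes \<open>a\<close> and \<open>b\<close>, its
    derivative is 1 at some mean value point \<open>\<xi>\<close>. The orbits of \<open>x\<close>
    and \<open>\<xi>\<close> stay in \<open>[a, b]\<close>, so each of the \<open>m\<close> terms
    contributes at most \<open>K * (b - a)\<close>.\<close>
  have distH: "\<bar>\<psi> m x\<bar> \<le> m * K * (b - a)"
    if ab: "a \<in> S" "b \<in> S" "a < b" "H a = a" "H b = b" and x: "x \<in> {a..b}" for a b x m
  proof -
    obtain \<xi> where \<xi>: "a < \<xi>" "\<xi> < b" "(H ^^ m) b - (H ^^ m) a = (b - a) * exp (\<psi> m \<xi>)"
      using mvt[OF ab(1-3)] by blast
    then have 0: "\<psi> m \<xi> = 0" using ab by (simp add: Hfix)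
    have inS: "y \<in> S" if "y \<in> {a..b}" for y using S[OF ab(1,2)] that by blast
    have "\<bar>\<psi> m x - \<psi> m \<xi>\<bar> \<le> (\<Sum>i<m. \<bar>ln (H' ((H ^^ i) x)) - ln (H' ((H ^^ i) \<xi>))\<bar>)"
      unfolding \<psi>_def sum_subtractf[symmetric] by (rule sum_abs)
    also have "\<dots> \<le> (\<Sum>i<m. K * (b - a))"
    proof (rule sum_mono)
      fix i
      have "\<bar>(H ^^ i) x - (H ^^ i) \<xi>\<bar> \<le> b - a"
        using monoHn'[of a x i] monoHn'[of a \<xi> i] monoHn'[of x b i] monoHn'[of \<xi> b i] x \<xi> inS ab
        by (auto simp: Hfix)
      then show "\<bar>ln (H' ((H ^^ i) x)) - ln (H' ((H ^^ i) \<xi>))\<bar> \<le> K * (b - a)"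
        using K(1)[of "(H ^^ i) x" "(H ^^ i) \<xi>"] K(2) x \<xi> inS HnS
        by (meson atLeastAtMost_iff less_imp_le mult_left_mono order_trans)
    qed
    finally show ?thesis using 0 by simp
  qed
  \<comment> \<open>Both sides are the logarithm of the derivative at \<open>x\<close> of one map,
    \<open>F ^^ n\<close> after \<open>H ^^ m\<close> or the other way round.\<close>
  have chain: "\<phi> n ((H ^^ m) x) + \<psi> m x = \<psi> m ((F ^^ n) x) + \<phi> n x" if x: "u < x" "x < v" for n m x
  proof -
    have xS: "x \<in> S" using J x by simp
    have *: "(H ^^ m) ` S \<subseteq> S" "(F ^^ n) ` S \<subseteq> S" using HnS FnS by auto
    have "((\<lambda>x. (F ^^ n) ((H ^^ m) x)) has_real_derivative exp (\<phi> n ((H ^^ m) x)) * exp (\<psi> m x)) (at x within S)"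
      using DERIV_image_chain[OF DERIV_subset[OF dF[OF HnS[OF xS]] *(1)] dH[OF xS]]
          by (simp add: comp_def)
    moreover have
        "((\<lambda>x. (H ^^ m) ((F ^^ n) x)) has_real_derivative exp (\<psi> m ((F ^^ n) x)) * exp (\<phi> n x)) (at x within S)"
      using DERIV_image_chain[OF DERIV_subset[OF dH[OF FnS[OF xS]] *(2)] dF[OF xS]]
          by (simp add: comp_def)
    then have
        "((\<lambda>x. (F ^^ n) ((H ^^ m) x)) has_real_derivative exp (\<psi> m ((F ^^ n) x)) * exp (\<phi> n x)) (at x within S)"
      by (rule has_field_derivative_transform_within[OF _ zero_less_one xS]) (simp add: comm)
    ultimately have "exp (\<phi> n ((H ^^ m) x)) * exp (\<psi> m x) = exp (\<psi> m ((F ^^ n) x)) * exp (\<phi> n x)"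
      unfolding at[OF u(1) v(1) x] by (rule DERIV_unique)
    then show ?thesis by (simp add: exp_add[symmetric])
  qed
  have "summable (\<lambda>i. (F ^^ i) v - (F ^^ i) u)"
    using monoFn'[OF u(1) v(1)] uv B by (intro summableI_nonneg_bounded[where x = B]) auto
  then have lim: "(\<lambda>i. (F ^^ i) v - (F ^^ i) u) \<longlonglongrightarrow> 0" by (rule summable_LIMSEQ_zero)
  \<comment> \<open>By \<open>chain\<close>, \<open>\<psi> m x\<close> is a distortion of
    \<open>F ^^ n\<close> plus \<open>\<psi> m\<close> at a point of the \<open>n\<close>-th image
    of \<open>(u, v)\<close>. For fixed \<open>m\<close> the latter tends to 0 with the length of
    that image as \<open>n\<close> grows.\<close>
  have bound: "\<bar>\<psi> m x\<bar> \<le> L * B" if x: "u < x" "x < v" for m x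
  proof -
    have "\<bar>\<psi> m x\<bar> \<le> L * B + m * K * ((F ^^ n) v - (F ^^ n) u)" for n
    proof -
      have "u < (H ^^ m) x" "(H ^^ m) x < v"
        using monoHn[of u x m] monoHn[of x v m] x J u v by (auto simp: Hfix)
      then have 1: "\<bar>\<phi> n x - \<phi> n ((H ^^ m) x)\<bar> \<le> L * B" using x by (intro distF) auto
      have "\<bar>\<psi> m ((F ^^ n) x)\<bar> \<le> m * K * ((F ^^ n) v - (F ^^ n) u)"
        using comm[OF u(1), of 1 n] comm[OF v(1), of 1 n] u v uv x J FnS
          monoFn[OF u(1) v(1) uv] monoFn'[of u x n] monoFn'[of x v n]
        by (intro distH) auto
      with 1 chain[OF x, of n m] show ?thesis by linarith
    qed
    moreover have "(\<lambda>n. L * B + m * K * ((F ^^ n) v - (F ^^ n) u)) \<longlonglongrightarrow> L * B + m * K * 0"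
      by (intro tendsto_intros lim)
    ultimately show ?thesis using LIMSEQ_le_const[of _ "L * B + m * K * 0" "\<bar>\<psi> m x\<bar>"] by auto
  qed
  define x where "x = (u + v) / 2"
  have x: "u < x" "x < v" using uv by (auto simp: x_def)
  have xS: "x \<in> S" using J x by simp
  have Hx: "u < H x" "H x < v"
    using monoHn[of u x 1] monoHn[of x v 1] x xS u v by auto
  let ?d = "H x - x" and ?c = "exp (- (L * B))"
  \<comment> \<open>All steps of the orbit of \<open>x\<close> have the sign of \<open>?d\<close>
    and at least the size \<open>\<bar>?d\<bar> * ?c\<close>, so enough of them would leave
    \<open>(u, v)\<close>.\<close>
  have step: "\<exists>e\<ge>?c. (H ^^ Suc m) x - (H ^^ m) x = ?d * e" for m
  proof -
    consider "x < H x" | "H x < x" using nofix[OF x] by linarith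
    then show ?thesis
    proof cases
      case 1
      then obtain \<xi> where \<xi>: "x < \<xi>" "\<xi> < H x" "(H ^^ m) (H x) - (H ^^ m) x = ?d * exp (\<psi> m \<xi>)"
        using mvt[OF xS HS[OF xS]] by blast
      then have "?c \<le> exp (\<psi> m \<xi>)" using bound[of \<xi> m] x Hx by simp
      with \<xi>(3) show ?thesis by (auto simp: funpow_swap1)
    next
      case 2
      then obtain \<xi> where \<xi>: "H x < \<xi>" "\<xi> < x"
          "(H ^^ m) x - (H ^^ m) (H x) = (x - H x) * exp (\<psi> m \<xi>)"
        using mvt[OF HS[OF xS] xS] by blast
      then have "?c \<le> exp (\<psi> m \<xi>)" using bound[of \<xi> m] x Hx by simp
      moreover have "(H ^^ Suc m) x - (H ^^ m) x = ?d * exp (\<psi> m \<xi>)"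
        using \<xi>(3) by (simp add: funpow_swap1 algebra_simps)
      ultimately show ?thesis by blast
    qed
  qed
  then obtain e where e: "\<And>m. ?c \<le> e m" "\<And>m. (H ^^ Suc m) x - (H ^^ m) x = ?d * e m" by metis
  have "real N * (\<bar>?d\<bar> * ?c) \<le> v - u" for N
  proof -
    have "(H ^^ N) x - x = (\<Sum>m<N. (H ^^ Suc m) x - (H ^^ m) x)"
      using sum_lessThan_telescope[of "\<lambda>m. (H ^^ m) x" N] by simp
    also have "\<dots> = ?d * (\<Sum>m<N. e m)" unfolding e(2) by (simp add: sum_distrib_left)
    finally have "\<bar>(H ^^ N) x - x\<bar> = \<bar>?d\<bar> * \<bar>\<Sum>m<N. e m\<bar>" by (simp add: abs_mult)
    moreover have "real N * ?c \<le> \<bar>\<Sum>m<N. e m\<bar>"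
      using sum_mono[of "{..<N}" "\<lambda>_. ?c" e] e(1) by simp
    ultimately have "\<bar>?d\<bar> * (real N * ?c) \<le> \<bar>(H ^^ N) x - x\<bar>" by (simp add: mult_left_mono)
    also have "\<dots> \<le> v - u"
      using monoHn[of u x N] monoHn[of x v N] x xS u v by (auto simp: Hfix)
    finally show ?thesis by (simp add: algebra_simps)
  qed
  moreover have "0 < \<bar>?d\<bar> * ?c" using nofix[OF x] by simp
  ultimately show False using reals_Archimedean3 by (metis not_le)
qed

section \<open>Diffeomorphisms of intervals\<close>

lemma C2_on_subset:
  assumes "C2_on S f" "T \<subseteq> S"
  shows "C2_on T f"
proof -
  from assms(1) obtain f' f'' where
    "\<forall>t\<in>S. (f has_vector_derivative f' t) (at t within S)"
    "\<forall>t\<in>S. (f' has_vector_derivative f'' t) (at t within S)" "continuous_on S f''"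
    unfolding C2_on_def by blast
  then show ?thesis
    unfolding C2_on_def using assms(2)
    by (intro exI[of _ f'] exI[of _ f''] conjI ballI continuous_on_subset[of S f'' T]
        has_vector_derivative_within_subset[where S = S and T = T]) auto
qed

text \<open>At limit points the derivative within \<open>S\<close> is unique, so the witness from
  \<open>C2_on\<close> agrees with the positive derivative given by orientation.\<close>

lemma C2_on_pos_derivatives:
  fixes f :: "real \<Rightarrow> real"
  assumes C2: "C2_on S f" and pos: "\<And>t. t \<in> S \<Longrightarrow> \<exists>d>0. (f has_vector_derivative d) (at t within S)"
    and lim: "\<And>t. t \<in> S \<Longrightarrow> t islimpt S"
  obtains f' f'' where "\<And>t. t \<in> S \<Longrightarrow> (f has_real_derivative f' t) (at t within S)"
    "\<And>t. t \<in> S \<Longrightarrow> f' t > 0"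
    "\<And>t. t \<in> S \<Longrightarrow> (f' has_real_derivative f'' t) (at t within S)" "continuous_on S f''"
proof -
  from C2 obtain f' f'' where d:
    "\<And>t. t \<in> S \<Longrightarrow> (f has_vector_derivative f' t) (at t within S)"
    "\<And>t. t \<in> S \<Longrightarrow> (f' has_vector_derivative f'' t) (at t within S)" "continuous_on S f''"
    unfolding C2_on_def by blast
  have "f' t > 0" if t: "t \<in> S" for t
  proof -
    obtain e where e: "e > 0" "(f has_vector_derivative e) (at t within S)" using pos[OF t] by blast
    have "f' t = e"
      using lim[OF t] vector_derivative_unique_within[of t S f] d(1)[OF t] e(2)
      by (simp add: trivial_limit_within)
    with e(1) show ?thesis by simp
  qed
  with d show thesis by (intro that) (auto simp: has_real_derivative_iff_has_vector_derivative)
qed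

text \<open>The derivative of \<open>ln (f' t)\<close> is \<open>f'' t / f' t\<close>. Second
  derivatives enter the distortion estimates through this bound.\<close>

lemma ln_deriv_lipschitz:
  fixes f' f'' :: "real \<Rightarrow> real"
  assumes "convex S" "\<And>t. t \<in> S \<Longrightarrow> f' t > 0"
    "\<And>t. t \<in> S \<Longrightarrow> (f' has_real_derivative f'' t) (at t within S)"
    "\<And>t. t \<in> S \<Longrightarrow> \<bar>f'' t / f' t\<bar> \<le> L" "x \<in> S" "y \<in> S"
  shows "\<bar>ln (f' x) - ln (f' y)\<bar> \<le> L * \<bar>x - y\<bar>"
proof -
  have "((\<lambda>t. ln (f' t)) has_real_derivative f'' t / f' t) (at t within S)" if "t \<in> S" for t
    using DERIV_chain'[OF assms(3)[OF that] DERIV_ln[OF assms(2)[OF that]]]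
    by (simp add: field_simps)
  from field_differentiable_bound[OF assms(1) this _ assms(5,6), of L] assms(4) show ?thesis
    by simp
qed

lemma compact_ratio_bounded:
  fixes f' f'' :: "real \<Rightarrow> real"
  assumes "compact S" "\<And>t. t \<in> S \<Longrightarrow> f' t > 0"
    "\<And>t. t \<in> S \<Longrightarrow> (f' has_real_derivative f'' t) (at t within S)" "continuous_on S f''"
  obtains L where "0 \<le> L" "\<And>t. t \<in> S \<Longrightarrow> \<bar>f'' t / f' t\<bar> \<le> L"
proof -
  have "continuous_on S f'" using assms(3) by (rule DERIV_continuous_on)
  then have "continuous_on S (\<lambda>t. f'' t / f' t)"
    using assms(2,4) by (intro continuous_on_divide) (auto simp: less_imp_neq[symmetric])
  then have "bounded ((\<lambda>t. f'' t / f' t) ` S)"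
    using assms(1) by (intro compact_imp_bounded compact_continuous_image)
  then obtain L where "L > 0" "\<And>t. t \<in> S \<Longrightarrow> \<bar>f'' t / f' t\<bar> \<le> L"
    unfolding bounded_pos by auto
  then show thesis using that[of L] by simp
qed

lemma pos_deriv_imp_strict_mono_on:
  fixes f :: "real \<Rightarrow> real"
  assumes ivl: "is_interval M"
    and pos: "\<And>t. t \<in> M \<Longrightarrow> \<exists>d>0. (f has_vector_derivative d) (at t within M)"
  shows "strict_mono_on M f"
proof (rule strict_mono_onI)
  note M = is_interval_Icc_subset[OF ivl]
  fix x y assume xy: "x \<in> M" "y \<in> M" "x < y"
  show "f x < f y"
  proof (rule DERIV_pos_imp_increasing_open[OF \<open>x < y\<close>])
    fix t assume t: "x < t" "t < y"
    then have "t \<in> M" "at t within M = at t"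
      using M[OF xy(1,2)] by (auto intro!: at_within_open_subset[of t "{x<..<y}"])
    with pos[of t] show "\<exists>d. (f has_real_derivative d) (at t) \<and> d > 0"
      by (auto simp: has_real_derivative_iff_has_vector_derivative)
  next
    have "continuous_on M f"
      using pos has_vector_derivative_continuous unfolding continuous_on_eq_continuous_within
          by blast
    then show "continuous_on {x..y} f" using M[OF xy(1,2)] by (rule continuous_on_subset)
  qed
qed

lemma last_fixed_point:
  fixes h :: "real \<Rightarrow> real"
  assumes "continuous_on {a..b} h" "a \<le> b" "h a = a"
  obtains u where "a \<le> u" "u \<le> b" "h u = u" "\<And>x. u < x \<Longrightarrow> x \<le> b \<Longrightarrow> h x \<noteq> x"
proof -
  let ?A = "{x \<in> {a..b}. h x = x}"
  have "closed ?A"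
  proof -
    have "closed ({a..b} \<inter> (\<lambda>x. h x - x) -` {0})"
      by (intro continuous_closed_preimage continuous_intros assms(1))
    also have "{a..b} \<inter> (\<lambda>x. h x - x) -` {0} = ?A" by auto
    finally show ?thesis .
  qed
  moreover have "a \<in> ?A" using assms by auto
  moreover have bdd: "bdd_above ?A" by (intro bdd_aboveI[of _ b]) auto
  ultimately have S: "Sup ?A \<in> ?A" using closed_contains_Sup[of ?A] by blast
  show thesis
  proof (rule that[of "Sup ?A"])
    fix x assume x: "Sup ?A < x" "x \<le> b"
    show "h x \<noteq> x"
    proof
      assume "h x = x"
      then have "x \<in> ?A" using x S by auto
      from cSup_upper[OF this bdd] x show False by simp
    qed
  qed (use S in auto)
qed

lemma first_fixed_point:
  fixes h :: "real \<Rightarrow> real"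
  assumes "continuous_on {a..b} h" "a \<le> b" "h b = b"
  obtains v where "a \<le> v" "v \<le> b" "h v = v" "\<And>x. a \<le> x \<Longrightarrow> x < v \<Longrightarrow> h x \<noteq> x"
proof -
  \<comment> \<open>Conjugation by the reflection \<open>x \<mapsto> -x\<close> turns first fixed
    points into last ones.\<close>
  let ?k = "\<lambda>x. - h (- x)"
  have "continuous_on {-b..-a} ?k"
    by (rule continuous_on_minus[OF continuous_on_compose2[OF assms(1)]])
      (auto intro: continuous_on_minus continuous_on_id)
  then obtain u where u: "-b \<le> u" "u \<le> -a" "?k u = u" "\<And>x. u < x \<Longrightarrow> x \<le> -a \<Longrightarrow> ?k x \<noteq> x"
    using last_fixed_point[of "-b" "-a" ?k] assms(2,3) by auto
  show thesis
  proof (rule that[of "-u"])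
    show "h x \<noteq> x" if "a \<le> x" "x < -u" for x using u(4)[of "-x"] that by auto
  qed (use u in auto)
qed

section \<open>Central commutators on intervals with a least element\<close>

lemma Diff2_intervalD:
  assumes "e \<in> carrier (Diff2_interval M)" "is_interval M"
  shows "e \<in> Bij M" "C2_on M e" "t \<in> M \<Longrightarrow> \<exists>d>0. (e has_vector_derivative d) (at t within M)"
    "order_aut M e" "continuous_on M e"
proof -
  have *: "\<exists>d>0. (e has_vector_derivative d) (at t within M)" if "t \<in> M" for t
    using assms(1) that by (auto simp: Diff2_interval_def)
  then show "t \<in> M \<Longrightarrow> \<exists>d>0. (e has_vector_derivative d) (at t within M)" .
  show Bij: "e \<in> Bij M" and "C2_on M e"
    using assms(1) by (auto simp: Diff2_interval_def)
  have "strict_mono_on M e" by (rule pos_deriv_imp_strict_mono_on[OF assms(2) *])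
  with Bij show "order_aut M e" by (auto simp: order_aut_def Bij_def bij_betw_def)
  show "continuous_on M e"
    using * has_vector_derivative_continuous unfolding continuous_on_eq_continuous_within by blast
qed

lemma Diff2_interval_mult:
  assumes "e \<in> Bij M" "d \<in> Bij M"
  shows "e \<otimes>\<^bsub>Diff2_interval M\<^esub> d = compose M e d"
  using assms by (simp add: Diff2_interval_def BijGroup_def)

text \<open>If \<open>e u < u\<close>, then \<open>e\<close> carries the component
  \<open>(u, v)\<close> of the points moved by \<open>c\<close> entirely below \<open>u\<close>. Its
  images under the iterates of \<open>e\<close> are then disjoint and lie above \<open>a\<close>, so
  \<open>(u, v)\<close> is a wandering interval.\<close>

lemma Diff2_interval_fixed_point_not_lowered:
  assumes ivl: "is_interval M" and a: "a \<in> M" "\<And>x. x \<in> M \<Longrightarrow> a \<le> x"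
    and e: "e \<in> carrier (Diff2_interval M)" and c: "c \<in> carrier (Diff2_interval M)"
    and ce: "\<And>x. x \<in> M \<Longrightarrow> c (e x) = e (c x)"
    and u: "u \<in> M" "c u = u" and p: "p \<in> M" "u < p"
    and nofix: "\<And>x. u < x \<Longrightarrow> x \<le> p \<Longrightarrow> c x \<noteq> x"
  shows "u \<le> e u"
proof (rule ccontr)
  assume "\<not> u \<le> e u"
  then have eu: "e u < u" by simp
  note De = Diff2_intervalD[OF e ivl] and Dc = Diff2_intervalD[OF c ivl]
      and M = is_interval_Icc_subset[OF ivl]
  \<comment> \<open>The preimage \<open>w\<close> of \<open>u\<close> is fixed by \<open>c\<close>
    and lies beyond \<open>p\<close>. Hence the component of \<open>p\<close> has a right end point
    \<open>v\<close> in \<open>M\<close>, also when \<open>M\<close> has no greatest element, and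
    \<open>v \<le> w\<close> gives \<open>e v \<le> u\<close>.\<close>
  obtain w where w: "w \<in> M" "e w = u" using order_aut_surj[OF De(4) u(1)] by blast
  have uw: "u < w" using order_aut_less[OF De(4) u(1) w(1)] w(2) eu by simp
  have cw: "c w = w"
  proof -
    have "e (c w) = e w" using ce[OF w(1)] by (simp only: w(2) u(2))
    then show ?thesis using order_aut_eq[OF De(4) order_aut_in[OF Dc(4) w(1)] w(1)] by blast
  qed
  have pw: "p < w" using nofix[OF uw] cw by force
  have "{p..w} \<subseteq> M" by (rule M[OF p(1) w(1)])
  then obtain v where v: "p \<le> v" "v \<le> w" "c v = v" "\<And>x. p \<le> x \<Longrightarrow> x < v \<Longrightarrow> c x \<noteq> x"
    using first_fixed_point[OF continuous_on_subset[OF Dc(5)] less_imp_le[OF pw] cw] by blast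
  have vM: "v \<in> M" using M[OF p(1) w(1)] v by auto
  \<comment> \<open>A compact interval that \<open>e\<close> and \<open>c\<close> map into itself,
    which supplies the Lipschitz constants.\<close>
  let ?S = "{a..v}"
  have SM: "?S \<subseteq> M" by (rule M[OF a(1) vM])
  have ev: "e v \<le> u" using order_aut_le[OF De(4) vM w(1)] v(2) w(2) by simp
  have au: "a \<le> u" by (rule a(2)[OF u(1)])
  have av: "a < v" using au p(2) v(1) by simp
  have maps: "d x \<in> ?S" if d: "order_aut M d" "d v \<le> v" and x: "x \<in> ?S" for d x
  proof -
    have xM: "x \<in> M" using x SM by blast
    have "d x \<le> d v" using order_aut_le[OF d(1) xM vM] x by simp
    then show ?thesis using a(2)[OF order_aut_in[OF d(1) xM]] d(2) by simp
  qed
  have eS: "e x \<in> ?S" if "x \<in> ?S" for x using maps[OF De(4) _ that] ev v(1) p(2) by simp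
  have cS: "c x \<in> ?S" if "x \<in> ?S" for x using maps[OF Dc(4) _ that] v(3) by simp
  have lip: "\<exists>d' L. (\<forall>x\<in>?S. (d has_real_derivative d' x) (at x within ?S) \<and> d' x > 0) \<and>
      (\<forall>x\<in>?S. \<forall>y\<in>?S. \<bar>ln (d' x) - ln (d' y)\<bar> \<le> L * \<bar>x - y\<bar>) \<and> 0 \<le> L"
    if d: "d \<in> carrier (Diff2_interval M)" for d
  proof -
    note Dd = Diff2_intervalD[OF d ivl]
    have "\<exists>r>0. (d has_vector_derivative r) (at t within ?S)" if "t \<in> ?S" for t
      using Dd(3)[of t] that SM has_vector_derivative_within_subset[OF _ SM] by blast
    moreover have "t islimpt ?S" if "t \<in> ?S" for t using that av by simp
    ultimately obtain d' d'' where d':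
      "\<And>t. t \<in> ?S \<Longrightarrow> (d has_real_derivative d' t) (at t within ?S)"
      "\<And>t. t \<in> ?S \<Longrightarrow> d' t > 0"
      "\<And>t. t \<in> ?S \<Longrightarrow> (d' has_real_derivative d'' t) (at t within ?S)" "continuous_on ?S d''"
      using C2_on_pos_derivatives[OF C2_on_subset[OF Dd(2) SM]] by blast
    obtain L where L: "0 \<le> L" "\<And>t. t \<in> ?S \<Longrightarrow> \<bar>d'' t / d' t\<bar> \<le> L"
      using compact_ratio_bounded[OF compact_Icc d'(2-4)] by blast
    have "\<bar>ln (d' x) - ln (d' y)\<bar> \<le> L * \<bar>x - y\<bar>" if "x \<in> ?S" "y \<in> ?S" for x y
      by (rule ln_deriv_lipschitz[OF _ d'(2,3) L(2) that]) auto
    with d'(1,2) L(1) show ?thesis by blast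
  qed
  obtain e' L where e': "\<And>x. x \<in> ?S \<Longrightarrow> (e has_real_derivative e' x) (at x within ?S)"
      "\<And>x. x \<in> ?S \<Longrightarrow> e' x > 0"
    "\<And>x y. x \<in> ?S \<Longrightarrow> y \<in> ?S \<Longrightarrow> \<bar>ln (e' x) - ln (e' y)\<bar> \<le> L * \<bar>x - y\<bar>" "0 \<le> L"
    using lip[OF e] by blast
  obtain c' K where c': "\<And>x. x \<in> ?S \<Longrightarrow> (c has_real_derivative c' x) (at x within ?S)"
      "\<And>x. x \<in> ?S \<Longrightarrow> c' x > 0"
    "\<And>x y. x \<in> ?S \<Longrightarrow> y \<in> ?S \<Longrightarrow> \<bar>ln (c' x) - ln (c' y)\<bar> \<le> K * \<bar>x - y\<bar>" "0 \<le> K"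
    using lip[OF c] by blast
  have smono: "strict_mono_on ?S d" if "order_aut M d" for d
    using that SM unfolding order_aut_def by (metis monotone_on_subset)
  \<comment> \<open>Since \<open>e v \<le> u\<close>, each length is at most the difference of
    consecutive points of the orbit of \<open>v\<close>, and these differences telescope.\<close>
  have sum: "(\<Sum>i<n. (e ^^ i) v - (e ^^ i) u) \<le> v - a" for n
  proof -
    have "(e ^^ i) (e v) \<le> (e ^^ i) u" for i
      using order_aut_le[OF order_aut_funpow[OF De(4)] order_aut_in[OF De(4) vM] u(1)] ev by blast
    then have "(\<Sum>i<n. (e ^^ i) v - (e ^^ i) u) \<le> (\<Sum>i<n. (e ^^ i) v - (e ^^ Suc i) v)"
      by (intro sum_mono) (simp add: funpow_swap1)
    also have "\<dots> = v - (e ^^ n) v" using sum_lessThan_telescope'[of "\<lambda>i. (e ^^ i) v" n] by simp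
    also have "\<dots> \<le> v - a" using a(2)[OF order_aut_in[OF order_aut_funpow[OF De(4)] vM]] by simp
    finally show ?thesis .
  qed
  show False
  proof (rule no_wandering_interval[of ?S e c e' c' L K u v "v - a"])
    show "c x \<noteq> x" if "u < x" "x < v" for x
      using nofix[of x] v(4)[of x] that by linarith
    show "is_interval ?S" by (rule is_interval_cc)
    show "c (e x) = e (c x)" if "x \<in> ?S" for x using ce that SM by blast
    show "u \<in> ?S" "v \<in> ?S" "u < v" using au av p(2) v(1) by auto
  qed (fact eS cS smono[OF De(4)] smono[OF Dc(4)] e' c' u(2) v(3) sum)+
qed

text \<open>On the left-closed interval \<open>M\<close> the last fixed point \<open>u\<close> of \<open>c\<close> before a
  point moved by \<open>c\<close> is fixed by \<open>f\<close> and \<open>g\<close>, since otherwise it would bound a wandering interval.\<close>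

lemma Diff2_interval_central_commutator:
  assumes ivl: "is_interval M" and a: "a \<in> M" "\<And>x. x \<in> M \<Longrightarrow> a \<le> x"
    and lim: "\<And>x. x \<in> M \<Longrightarrow> x islimpt M"
    and carr: "f \<in> carrier (Diff2_interval M)" "g \<in> carrier (Diff2_interval M)"
        "c \<in> carrier (Diff2_interval M)"
    and fg: "f \<otimes>\<^bsub>Diff2_interval M\<^esub> g = c \<otimes>\<^bsub>Diff2_interval M\<^esub> (g \<otimes>\<^bsub>Diff2_interval M\<^esub> f)"
    and cf: "c \<otimes>\<^bsub>Diff2_interval M\<^esub> f = f \<otimes>\<^bsub>Diff2_interval M\<^esub> c"
    and cg: "c \<otimes>\<^bsub>Diff2_interval M\<^esub> g = g \<otimes>\<^bsub>Diff2_interval M\<^esub> c"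
  shows "c = \<one>\<^bsub>Diff2_interval M\<^esub>"
proof (rule ccontr)
  assume ne: "c \<noteq> \<one>\<^bsub>Diff2_interval M\<^esub>"
  interpret G: group "Diff2_interval M" by (rule Diff2_interval_group[OF lim])
  note D = Diff2_intervalD[OF _ ivl] and M = is_interval_Icc_subset[OF ivl]
  have eval: "(d \<otimes>\<^bsub>Diff2_interval M\<^esub> e) x = d (e x)"
    if "d \<in> carrier (Diff2_interval M)" "e \<in> carrier (Diff2_interval M)" "x \<in> M" for d e x
    using Diff2_interval_mult[OF D(1)[OF that(1)] D(1)[OF that(2)]] that(3)
        by (simp add: compose_eq)
  have one: "\<one>\<^bsub>Diff2_interval M\<^esub> = (\<lambda>x\<in>M. x)" by (simp add: Diff2_interval_def BijGroup_def)
  have ext: "c \<in> extensional M" using D(1)[OF carr(3)] by (simp add: Bij_def)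
  obtain p where p: "p \<in> M" "c p \<noteq> p"
    using ne extensionalityI[OF ext, of "\<lambda>x\<in>M. x"] unfolding one by auto
  have fgx: "f (g x) = c (g (f x))" and cfx: "c (f x) = f (c x)" and cgx: "c (g x) = g (c x)"
    if "x \<in> M" for x
    using fun_cong[OF fg, of x] fun_cong[OF cf, of x] fun_cong[OF cg, of x] carr that
    by (auto simp: eval)
  have "c a = a"
  proof -
    obtain z where z: "z \<in> M" "c z = a" using order_aut_surj[OF D(4)[OF carr(3)] a(1)] by blast
    then show ?thesis
      using order_aut_le[OF D(4)[OF carr(3)] a(1) z(1)] a order_aut_in[OF D(4)[OF carr(3)]]
      by (metis order_antisym)
  qed
  then obtain u where u: "a \<le> u" "u \<le> p" "c u = u" "\<And>x. u < x \<Longrightarrow> x \<le> p \<Longrightarrow> c x \<noteq> x"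
    using last_fixed_point[of a p c] continuous_on_subset[OF D(5)[OF carr(3)] M[OF a(1) p(1)]]
        a(2)[OF p(1)]
    by blast
  have uM: "u \<in> M" using M[OF a(1) p(1)] u by auto
  have up: "u < p" using u(2,3) p(2) by (cases "u = p") auto
  \<comment> \<open>Neither \<open>e\<close> nor its inverse can lower \<open>u\<close>, so
    \<open>u\<close> is fixed.\<close>
  have fixu: "e u = u" if e: "e \<in> carrier (Diff2_interval M)"
    and ce: "c \<otimes>\<^bsub>Diff2_interval M\<^esub> e = e \<otimes>\<^bsub>Diff2_interval M\<^esub> c" for e
  proof (rule order_antisym)
    have cex: "c (e x) = e (c x)" if "x \<in> M" for x
      using fun_cong[OF ce, of x] carr e that by (simp add: eval)
    show "u \<le> e u"
      by (rule Diff2_interval_fixed_point_not_lowered[of M a e c u p]) (fact ivl a e carr cex uM u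
          p up)+
    let ?i = "inv\<^bsub>Diff2_interval M\<^esub> e"
    have i: "?i \<in> carrier (Diff2_interval M)" using e by simp
    have ei: "e (?i x) = x" if "x \<in> M" for x
    proof -
      have "(e \<otimes>\<^bsub>Diff2_interval M\<^esub> ?i) x = x" unfolding G.r_inv[OF e] one using that by simp
      then show ?thesis by (simp only: eval[OF e i that])
    qed
    have iM: "?i x \<in> M" if "x \<in> M" for x using order_aut_in[OF D(4)[OF i] that] .
    have cM: "c x \<in> M" if "x \<in> M" for x using order_aut_in[OF D(4)[OF carr(3)] that] .
    have cix: "c (?i x) = ?i (c x)" if "x \<in> M" for x
    proof -
      have "e (c (?i x)) = c x" using cex[OF iM[OF that]] by (simp only: ei[OF that])
      then have "e (c (?i x)) = e (?i (c x))" by (simp only: ei[OF cM[OF that]])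
      then show ?thesis
        using order_aut_eq[OF D(4)[OF e] cM[OF iM[OF that]] iM[OF cM[OF that]]] by blast
    qed
    have "u \<le> ?i u"
      by (rule Diff2_interval_fixed_point_not_lowered[of M a ?i c u p]) (fact ivl a i carr cix uM
          u p up)+
    then show "e u \<le> u"
      using order_aut_le[OF D(4)[OF e] uM iM[OF uM]] ei[OF uM] by simp
  qed
  show False
    by (rule germ_not_archimedean[of M f g c u p])
      (fact ivl D(4)[OF carr(1)] D(4)[OF carr(2)] D(4)[OF carr(3)] D(5)[OF carr(3)] fgx cfx cgx uM
        fixu[OF carr(1) cf] fixu[OF carr(2) cg] p up u)+
qed

section \<open>Diffeomorphisms of the circle\<close>

text \<open>The increment \<open>b\<close> is separate from the period \<open>a\<close>: lifts of
  circle maps have \<open>b = a\<close>, their derivatives have \<open>b = 0\<close>.\<close>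

lemma quasi_periodic_shift:
  fixes F :: "real \<Rightarrow> real"
  assumes "\<And>t. F (t + a) = F t + b"
  shows "F (t + a * of_int n) = F t + b * of_int n"
proof -
  have nat: "F (t + a * of_nat n) = F t + b * of_nat n" for n t
  proof (induction n)
    case (Suc n)
    have "F (t + a * of_nat (Suc n)) = F ((t + a * of_nat n) + a)" by (simp add: algebra_simps)
    also have "\<dots> = F t + b * of_nat n + b" using assms Suc by simp
    finally show ?case by (simp add: algebra_simps)
  qed simp
  show ?thesis
  proof (cases n rule: int_cases2)
    case (nonneg m)
    then show ?thesis using nat[of t m] by simp
  next
    case (nonpos m)
    then show ?thesis using nat[of "t - a * of_nat m" m] by simp
  qed
qed

section \<open>Lifts of circle maps through \<open>cis\<close>\<close>

lemma cis_eq_cis_iff: "cis x = cis y \<longleftrightarrow> (\<exists>k::int. x = y + 2 * pi * of_int k)"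
  using sin_cos_eq_iff[of x y] by (auto simp: complex_eq_iff)

text \<open>The difference divided by \<open>2 * pi\<close> is continuous with integer values, hence
  constant on the line.\<close>

lemma cis_eq_imp_const_shift:
  fixes A B :: "real \<Rightarrow> real"
  assumes cont: "continuous_on UNIV A" "continuous_on UNIV B" and eq: "\<And>t. cis (A t) = cis (B t)"
  obtains k :: int where "\<And>t. A t = B t + 2 * pi * of_int k"
proof -
  let ?q = "\<lambda>t. (A t - B t) / (2 * pi)"
  have int: "\<exists>k::int. ?q t = of_int k" for t
    using eq[of t] by (auto simp: cis_eq_cis_iff)
  have "?q constant_on UNIV"
  proof (rule continuous_discrete_range_constant)
    show "continuous_on UNIV ?q" using cont by (intro continuous_intros) auto
    fix x
    show "\<exists>e>0. \<forall>y. y \<in> UNIV \<and> ?q y \<noteq> ?q x \<longrightarrow> e \<le> norm (?q y - ?q x)"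
    proof (intro exI[of _ 1] conjI allI impI)
      fix y assume ne: "y \<in> UNIV \<and> ?q y \<noteq> ?q x"
      obtain i j :: int where ij: "?q y = of_int i" "?q x = of_int j" using int by metis
      with ne have "i \<noteq> j" by auto
      then have "1 \<le> \<bar>i - j\<bar>" by simp
      then have "1 \<le> \<bar>of_int i - of_int j :: real\<bar>"
          by (metis of_int_1_le_iff of_int_abs of_int_diff)
      then show "1 \<le> norm (?q y - ?q x)" unfolding ij by simp
    qed simp
  qed (rule connected_UNIV)
  then obtain c where c: "\<And>t. ?q t = c" unfolding constant_on_def by blast
  obtain k :: int where "?q 0 = of_int k" using int by blast
  then have "A t = B t + 2 * pi * of_int k" for t
    using c[of t] c[of 0] by (simp add: field_simps)
  then show thesis by (rule that)
qed

text \<open>These are lifts to the line of orientation-preserving circle diffeomorphisms; the last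
  clause says that the degree is 1.\<close>

definition circle_lift :: "(real \<Rightarrow> real) \<Rightarrow> bool" where
  "circle_lift F \<longleftrightarrow> C2_on UNIV F \<and> (\<forall>t. \<exists>d>0. (F has_vector_derivative d) (at t)) \<and>
    (\<forall>t. F (t + 2 * pi) = F t + 2 * pi)"

lemma circle_lift_shift: "circle_lift F \<Longrightarrow> F (t + 2 * pi * of_int k) = F t + 2 * pi * of_int k"
  by (rule quasi_periodic_shift) (simp add: circle_lift_def)

lemma circle_lift_continuous: "circle_lift F \<Longrightarrow> continuous_on S F"
  unfolding circle_lift_def
  by (meson continuous_at_imp_continuous_on has_vector_derivative_continuous)

lemma circle_lift_order_aut:
  assumes F: "circle_lift F"
  shows "order_aut UNIV F"
proof -
  have "strict_mono_on UNIV F"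
    using F by (intro pos_deriv_imp_strict_mono_on) (auto simp: circle_lift_def)
  moreover have "\<exists>x. F x = y" for y
  proof -
    obtain n :: int where n: "\<bar>y - F 0\<bar> / (2 * pi) \<le> of_int n" using ex_le_of_int by blast
    then have le: "\<bar>y - F 0\<bar> \<le> 2 * pi * of_int n" by (simp add: field_simps)
    have n0: "0 \<le> (of_int n :: real)" using n by (rule order_trans[rotated]) simp
    have "F (0 + 2 * pi * of_int (- n)) \<le> y" "y \<le> F (0 + 2 * pi * of_int n)"
      unfolding circle_lift_shift[OF F] using le by auto
    then have "\<exists>x\<ge>0 + 2 * pi * of_int (- n). x \<le> 0 + 2 * pi * of_int n \<and> F x = y"
      using n0 by (intro IVT' circle_lift_continuous[OF F]) auto
    then show ?thesis by blast
  qed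
  ultimately show ?thesis unfolding order_aut_def by (metis surj_def)
qed

lemma circle_lift_add_const:
  assumes "circle_lift F"
  shows "circle_lift (\<lambda>t. F t + c)"
proof -
  obtain F' F'' where d: "\<And>t. (F has_vector_derivative F' t) (at t)"
    "\<And>t. (F' has_vector_derivative F'' t) (at t)" "continuous_on UNIV F''"
    using assms unfolding circle_lift_def C2_on_def by auto
  have "((\<lambda>t. F t + c) has_vector_derivative F' t) (at t)" for t
    using has_vector_derivative_add[OF d(1) has_vector_derivative_const[of c]] by simp
  with d have "C2_on UNIV (\<lambda>t. F t + c)" unfolding C2_on_def by auto
  moreover have "\<exists>e>0. ((\<lambda>t. F t + c) has_vector_derivative e) (at t)" for t
  proof -
    obtain e where "e > 0" "(F has_vector_derivative e) (at t)"
      using assms unfolding circle_lift_def by blast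
    then show ?thesis
      using has_vector_derivative_add[OF _ has_vector_derivative_const[of c], of F e "at t"] by auto
  qed
  ultimately show ?thesis using assms by (simp add: circle_lift_def)
qed

text \<open>The lift \<open>h\<close> increases, so its degree \<open>k\<close> is positive. If
  \<open>k\<close> exceeded 1, \<open>h\<close> would reach \<open>h t + 2 * pi\<close> strictly
  between \<open>t\<close> and \<open>t + 2 * pi\<close>, contradicting the injectivity of
  \<open>e\<close>.\<close>

lemma circle_lift_exists:
  assumes e: "e \<in> carrier Diff2_circle"
  obtains F where "circle_lift F" "\<And>t. e (cis t) = cis (F t)"
proof -
  have D: "e \<in> Bij circle" "C2_on UNIV (\<lambda>t. e (cis t))"
    "\<And>t. \<exists>d>0. ((\<lambda>s. e (cis s)) has_vector_derivative d *\<^sub>R (\<i> * e (cis t))) (at t)"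
    using e by (auto simp: Diff2_circle_def)
  have bij: "bij_betw e circle circle" using D(1) by (simp add: Bij_def)
  have n: "norm (e (cis t)) = 1" for t using bij_betw_apply[OF bij, of "cis t"] by simp
  obtain h where h: "C2_on UNIV h" "\<And>t. e (cis t) = cis (h t)"
    "\<And>t d. ((\<lambda>t. e (cis t)) has_vector_derivative d *\<^sub>R (\<i> * e (cis t))) (at t) \<longleftrightarrow> (h has_vector_derivative d) (at t)"
    by (rule C2_circle_lift[OF D(2) n]) blast
  have pos: "\<exists>d>0. (h has_vector_derivative d) (at t)" for t using D(3) h(3) by blast
  have "strict_mono_on UNIV h" using pos by (intro pos_deriv_imp_strict_mono_on) auto
  then have mono: "h x < h y" if "x < y" for x y using that by (simp add: strict_mono_onD)
  have cont: "continuous_on S h" for S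
    using pos by (meson continuous_at_imp_continuous_on has_vector_derivative_continuous)
  have inj: "cis s = cis t" if "cis (h s) = cis (h t)" for s t
  proof -
    have "e (cis s) = e (cis t)" using that h(2) by simp
    then show ?thesis using bij by (auto simp: bij_betw_def inj_on_def)
  qed
  have "h (t + 2 * pi) = h t + 2 * pi" for t
  proof -
    have "cis (t + 2 * pi) = cis t" by (simp add: complex_eq_iff)
    then have "cis (h (t + 2 * pi)) = cis (h t)" using h(2) by metis
    then obtain k :: int where k: "h (t + 2 * pi) = h t + 2 * pi * of_int k"
      unfolding cis_eq_cis_iff by blast
    have "h t < h (t + 2 * pi)" by (rule mono) simp
    then have "0 < k" unfolding k by (simp add: zero_less_mult_iff)
    moreover have "\<not> 1 < k"
    proof
      assume "1 < k"
      then have lt: "h t + 2 * pi < h (t + 2 * pi)" unfolding k by simp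
      then obtain s where s: "t \<le> s" "s \<le> t + 2 * pi" "h s = h t + 2 * pi"
        using IVT'[of h t "h t + 2 * pi" "t + 2 * pi"] cont by auto
      have "cis (h s) = cis (h t)" unfolding s(3) by (simp add: complex_eq_iff)
      then obtain j :: int where j: "s = t + 2 * pi * of_int j" using inj unfolding cis_eq_cis_iff
          by blast
      have "s \<noteq> t" "s \<noteq> t + 2 * pi" using s(3) lt by auto
      with s have "t < s" "s < t + 2 * pi" by auto
      then have "0 < 2 * pi * real_of_int j" "2 * pi * real_of_int j < 2 * pi * 1" unfolding j
          by simp_all
      then have "0 < real_of_int j" "real_of_int j < 1" by (simp_all add: zero_less_mult_iff)
      then show False by simp
    qed
    ultimately have "k = 1" by simp
    with k show ?thesis by simp
  qed
  then have "circle_lift h" using h(1) pos by (simp add: circle_lift_def)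
  then show thesis using h(2) by (rule that)
qed

text \<open>The first two derivatives of a lift are periodic, so the bound on one compact period
  holds on the whole line.\<close>

lemma circle_lift_ln_deriv_lipschitz:
  assumes F: "circle_lift F"
  obtains F' L where "\<And>t. (F has_real_derivative F' t) (at t)" "\<And>t. F' t > 0"
    "\<And>x y. \<bar>ln (F' x) - ln (F' y)\<bar> \<le> L * \<bar>x - y\<bar>" "0 \<le> L"
proof -
  obtain F' F'' where d: "\<And>t. (F has_real_derivative F' t) (at t)" "\<And>t. F' t > 0"
    "\<And>t. (F' has_real_derivative F'' t) (at t)" "continuous_on UNIV F''"
    using C2_on_pos_derivatives[of UNIV F] F unfolding circle_lift_def by auto
  have F'_per: "F' (t + 2 * pi) = F' t" for t
  proof -
    have "((\<lambda>s. F (s + 2 * pi)) has_real_derivative F' (t + 2 * pi)) (at t)"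
      using d(1)[of "t + 2 * pi"] by (simp add: DERIV_shift)
    moreover have "((\<lambda>s. F (s + 2 * pi)) has_real_derivative F' t) (at t)"
      using F d(1)[of t] unfolding circle_lift_def by (auto intro!: derivative_eq_intros)
    ultimately show ?thesis by (rule DERIV_unique)
  qed
  have F''_per: "F'' (t + 2 * pi) = F'' t" for t
  proof -
    have "((\<lambda>s. F' (s + 2 * pi)) has_real_derivative F'' (t + 2 * pi)) (at t)"
      using d(3)[of "t + 2 * pi"] by (simp add: DERIV_shift)
    then show ?thesis unfolding F'_per using d(3)[of t] by (rule DERIV_unique)
  qed
  obtain L where L: "0 \<le> L" "\<And>t. t \<in> {0..2 * pi} \<Longrightarrow> \<bar>F'' t / F' t\<bar> \<le> L"
    by (rule compact_ratio_bounded[OF compact_Icc d(2)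
          has_field_derivative_at_within[OF d(3)] continuous_on_subset[OF d(4) subset_UNIV]]) blast
  have "\<bar>F'' t / F' t\<bar> \<le> L" for t
  proof -
    define n where "n = \<lfloor>t / (2 * pi)\<rfloor>"
    define s where "s = t - 2 * pi * of_int n"
    have "of_int n \<le> t / (2 * pi)" "t / (2 * pi) < of_int n + 1" unfolding n_def by linarith+
    then have "s \<in> {0..2 * pi}" by (simp add: s_def field_simps)
    then have "\<bar>F'' s / F' s\<bar> \<le> L" by (rule L(2))
    moreover have "F' t = F' s" "F'' t = F'' s"
      using quasi_periodic_shift[of F' "2 * pi" 0 s n] quasi_periodic_shift[of F'' "2 * pi" 0 s n]
        F'_per F''_per by (auto simp: s_def)
    ultimately show ?thesis by simp
  qed
  then have "\<bar>ln (F' x) - ln (F' y)\<bar> \<le> L * \<bar>x - y\<bar>" for x y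
    using d(2,3) by (intro ln_deriv_lipschitz[of UNIV F' F'' L]) auto
  with d(1,2) L(1) show thesis by (intro that)
qed

text \<open>A central commutator on the line has a fixed point, and a translation has one only if it
  is trivial. This turns commutation modulo \<open>2 * pi\<close> into exact commutation of
  lifts.\<close>

lemma translation_not_commutator:
  fixes f g :: "real \<Rightarrow> real"
  assumes f: "order_aut UNIV f" and g: "order_aut UNIV g"
    and fg: "\<And>x. f (g x) = g (f x) + s" and fs: "\<And>x. f (x + s) = f x + s"
        and gs: "\<And>x. g (x + s) = g x + s"
  shows "s = 0"
proof -
  have "order_aut UNIV (\<lambda>x. x + s)"
    unfolding order_aut_def by (auto simp: strict_mono_on_def surj_def intro: exI[of _ "_ - s"])
  then have "\<exists>x\<in>UNIV. x + s = x"
    using fg fs gs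
    by (intro central_commutator_fixed_point[where f = f and g = g and M = UNIV and p = 0] f g)
      (auto intro!: continuous_intros)
  then show ?thesis by simp
qed

text \<open>Shifting each interval by a multiple of \<open>2 * pi\<close> so that it starts in
  \<open>[0, 2 * pi]\<close> places disjoint intervals inside \<open>[0, 4 * pi]\<close>; their
  measures add up.\<close>

lemma sum_length_disjoint_mod_2pi:
  fixes a b :: "nat \<Rightarrow> real"
  assumes ab: "\<And>i. i < n \<Longrightarrow> a i \<le> b i" "\<And>i. i < n \<Longrightarrow> b i \<le> a i + 2 * pi"
    and disj: "\<And>i j k x. i < n \<Longrightarrow> j < n \<Longrightarrow> i \<noteq> j \<Longrightarrow>
      a i < x \<Longrightarrow> x < b i \<Longrightarrow> a j + 2 * pi * of_int k < x \<Longrightarrow> x < b j + 2 * pi * of_int k \<Longrightarrow> False"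
  shows "(\<Sum>i<n. b i - a i) \<le> 4 * pi"
proof -
  define r where "r i = \<lfloor>a i / (2 * pi)\<rfloor>" for i
  define A where "A i = {a i - 2 * pi * of_int (r i) <..< b i - 2 * pi * of_int (r i)}" for i
  have r: "0 \<le> a i - 2 * pi * of_int (r i)" "a i - 2 * pi * of_int (r i) \<le> 2 * pi" for i
  proof -
    have "of_int (r i) \<le> a i / (2 * pi)" "a i / (2 * pi) < of_int (r i) + 1" unfolding r_def
        by linarith+
    then show "0 \<le> a i - 2 * pi * of_int (r i)" "a i - 2 * pi * of_int (r i) \<le> 2 * pi"
      by (simp_all add: field_simps)
  qed
  have "disjoint_family_on A {..<n}"
    unfolding disjoint_family_on_def
  proof (intro ballI impI equals0I)
    fix i j x assume ij: "i \<in> {..<n}" "j \<in> {..<n}" "i \<noteq> j" and x: "x \<in> A i \<inter> A j"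
    show False
      using disj[of i j "x + 2 * pi * of_int (r i)" "r i - r j"] ij x
      by (auto simp: A_def algebra_simps)
  qed
  then have "measure lborel (\<Union>(A ` {..<n})) = (\<Sum>i<n. measure lborel (A i))"
    using ab(1) by (intro measure_finite_Union) (auto simp: A_def[abs_def])
  also have "\<dots> = (\<Sum>i<n. b i - a i)" using ab by (intro sum.cong) (auto simp: A_def)
  finally have "(\<Sum>i<n. b i - a i) = measure lborel (\<Union>(A ` {..<n}))" by simp
  also have "\<dots> \<le> measure lborel {0..4 * pi}"
  proof (rule measure_mono_fmeasurable)
    show "\<Union>(A ` {..<n}) \<subseteq> {0..4 * pi}" 
    proof
      fix x assume "x \<in> \<Union>(A ` {..<n})"
      then obtain i where "i < n" "x \<in> A i" by blast
      then show "x \<in> {0..4 * pi}" using r[of i] ab(2)[of i] by (simp add: A_def)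
    qed
  qed (auto simp: A_def fmeasurable_def)
  finally show ?thesis by simp
qed

section \<open>Periodic points and central commutators of lifts\<close>

lemma circle_lift_funpow_shift:
  assumes "circle_lift F"
  shows "(F ^^ n) (t + 2 * pi * of_int k) = (F ^^ n) t + 2 * pi * of_int k"
  by (induction n) (simp_all add: circle_lift_shift[OF assms])

text \<open>If the rotation number of \<open>E\<close> is irrational then the iterates of a component of the complement
  of the fixed point set of \<open>H\<close> are disjoint modulo \<open>2 * pi\<close>.\<close>

lemma circle_lift_periodic:
  assumes E: "circle_lift E" and H: "circle_lift H" and HE: "\<And>x. H (E x) = E (H x)"
    and u: "H u = u" and v: "H v = v" and uv: "u < v" "v \<le> u + 2 * pi"
    and nofix: "\<And>x. u < x \<Longrightarrow> x < v \<Longrightarrow> H x \<noteq> x"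
  shows "\<exists>q>0. \<exists>k::int. (E ^^ q) u = u + 2 * pi * of_int k"
proof (rule ccontr)
  assume "\<not> ?thesis"
  then have nper: "(E ^^ q) u \<noteq> u + 2 * pi * of_int k" if "q > 0" for q and k :: int
    using that by blast
  note oE = circle_lift_order_aut[OF E] and oH = circle_lift_order_aut[OF H]
  note oEn = order_aut_funpow[OF oE]
  have lessE: "(E ^^ n) x < (E ^^ n) y \<longleftrightarrow> x < y" for n x y by (rule order_aut_less[OF oEn]) auto
  have leE: "(E ^^ n) x \<le> (E ^^ n) y \<longleftrightarrow> x \<le> y" for n x y by (rule order_aut_le[OF oEn]) auto
  have comm: "H ((E ^^ n) x) = (E ^^ n) (H x)" for n x by (induction n) (simp_all add: HE)
  have fixed: "H ((E ^^ n) x + 2 * pi * of_int k) = (E ^^ n) x + 2 * pi * of_int k" if "H x = x"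
      for n x k
    using that by (simp add: circle_lift_shift[OF H] comm)
  have unfixed: "H x \<noteq> x"
    if x: "(E ^^ n) u + 2 * pi * of_int k < x" "x < (E ^^ n) v + 2 * pi * of_int k" for n x
        and k :: int
  proof
    assume Hx: "H x = x"
    obtain y where y: "(E ^^ n) y = x - 2 * pi * of_int k" using order_aut_surj[OF oEn] by blast
    then have "(E ^^ n) u < (E ^^ n) y" "(E ^^ n) y < (E ^^ n) v" using x by simp_all
    then have "H y \<noteq> y" unfolding lessE by (rule nofix)
    moreover have "(E ^^ n) (H y) = (E ^^ n) y"
      using circle_lift_shift[OF H, of x "- k"] Hx unfolding comm[symmetric] y by simp
    ultimately show False using order_aut_eq[OF oEn] by blast
  qed
  \<comment> \<open>Two left end points that agree modulo \<open>2 * pi\<close> would make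
    \<open>u\<close> periodic with \<open>q = j - i\<close>.\<close>
  have left_ne: "(E ^^ i) u \<noteq> (E ^^ j) u + 2 * pi * of_int k" if "i < j" for i j and k :: int
  proof
    assume eq: "(E ^^ i) u = (E ^^ j) u + 2 * pi * of_int k"
    have "(E ^^ i) ((E ^^ (j - i)) u) = (E ^^ j) u"
      using that by (metis funpow_add le_add_diff_inverse less_imp_le o_apply)
    also have "\<dots> = (E ^^ i) (u + 2 * pi * of_int (- k))"
      using eq unfolding circle_lift_funpow_shift[OF E] by simp
    finally have "(E ^^ (j - i)) u = u + 2 * pi * of_int (- k)" using order_aut_eq[OF oEn] by blast
    with nper[of "j - i" "- k"] that show False by simp
  qed
  have left_ne': "(E ^^ i) u \<noteq> (E ^^ j) u + 2 * pi * of_int k" if "i \<noteq> j" for i j and k :: int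
    using left_ne[of i j k] left_ne[of j i "- k"] that by (cases "i < j") auto
  have sum: "(\<Sum>i<n. (E ^^ i) v - (E ^^ i) u) \<le> 4 * pi" for n
  proof (rule sum_length_disjoint_mod_2pi)
    show "(E ^^ i) u \<le> (E ^^ i) v" for i using leE uv(1) by simp
    show "(E ^^ i) v \<le> (E ^^ i) u + 2 * pi" for i
      using leE[of i v "u + 2 * pi * of_int 1"] uv(2) unfolding circle_lift_funpow_shift[OF E]
          by simp
    fix i j x and k :: int
    let ?a = "(E ^^ i) u" and ?a' = "(E ^^ j) u + 2 * pi * of_int k"
    assume "i \<noteq> j" and x: "?a < x" "x < (E ^^ i) v" "?a' < x" "x < (E ^^ j) v + 2 * pi * of_int k"
    \<comment> \<open>If two images overlap, the larger left end point lies inside the other image.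
      It is fixed by \<open>H\<close>, but \<open>H\<close> fixes no interior point.\<close>
    from left_ne'[OF \<open>i \<noteq> j\<close>] consider "?a < ?a'" | "?a' < ?a" by (meson linorder_neqE)
    then show False
    proof cases
      case 1
      then have "H ?a' \<noteq> ?a'" using unfixed[of i 0 ?a'] x by simp
      with fixed[OF u] show False by blast
    next
      case 2
      then have "H ?a \<noteq> ?a" using unfixed[of j k ?a] x by simp
      with fixed[OF u, of i 0] show False by simp
    qed
  qed
  obtain E' L where E': "\<And>t. (E has_real_derivative E' t) (at t)" "\<And>t. E' t > 0"
    "\<And>x y. \<bar>ln (E' x) - ln (E' y)\<bar> \<le> L * \<bar>x - y\<bar>" "0 \<le> L"
    using circle_lift_ln_deriv_lipschitz[OF E] by blast
  obtain H' K where H': "\<And>t. (H has_real_derivative H' t) (at t)" "\<And>t. H' t > 0"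
    "\<And>x y. \<bar>ln (H' x) - ln (H' y)\<bar> \<le> K * \<bar>x - y\<bar>" "0 \<le> K"
    using circle_lift_ln_deriv_lipschitz[OF H] by blast
  have smono: "strict_mono_on UNIV E" "strict_mono_on UNIV H"
    using oE oH by (auto simp: order_aut_def)
  show False
    by (rule no_wandering_interval[of UNIV E H E' H' L K u v "4 * pi"])
      (rule is_interval_univ UNIV_I E' H' smono HE u v uv(1) nofix sum | assumption)+
qed

text \<open>The orbit of a moved point is strictly monotone and cannot return. Passing to a power of
  the central element thus creates no new fixed points.\<close>

lemma order_aut_funpow_fixed:
  assumes h: "order_aut M h" and x: "x \<in> M" "(h ^^ n) x = x" and n: "n > 0"
  shows "h x = x"
proof (rule ccontr)
  assume "h x \<noteq> x"
  then consider "h x < x" | "x < h x" by (meson linorder_neqE)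
  then show False
  proof cases
    case 1
    from order_aut_funpow_less[OF h x(1) 1 n] x(2) show False by simp
  next
    case 2
    have "x < (h ^^ Suc m) x" for m
    proof (induction m)
      case (Suc m)
      have "h x < (h ^^ Suc (Suc m)) x"
        using Suc order_aut_less[OF h x(1), of "(h ^^ Suc m) x"]
          order_aut_in[OF order_aut_funpow[OF h] x(1), of "Suc m"] by simp
      with 2 show ?case by (rule less_trans)
    qed (use 2 in simp)
    from this[of "n - 1"] x(2) n show False by simp
  qed
qed

text \<open>On the circle, \<open>F\<close> and \<open>G\<close> need only make the end point
  \<open>u\<close> periodic modulo \<open>2 * pi\<close>. Suitable powers, corrected by
  translations, fix \<open>u\<close> and have a power of \<open>H\<close> as commutator, so the
  argument at a common fixed point applies to them.\<close>

lemma circle_lifts_central_commutator: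
  assumes F: "circle_lift F" and G: "circle_lift G" and H: "circle_lift H"
    and FG: "\<And>x. F (G x) = H (G (F x))"
    and HF: "\<And>x. H (F x) = F (H x)" and HG: "\<And>x. H (G x) = G (H x)"
  shows "H x = x"
proof (rule ccontr)
  assume "H x \<noteq> x"
  note oF = circle_lift_order_aut[OF F] and oG = circle_lift_order_aut[OF G]
      and oH = circle_lift_order_aut[OF H]
  note cH = circle_lift_continuous[OF H]
  have "\<exists>z\<in>UNIV. H z = z"
    by (rule central_commutator_fixed_point[where f = F and g = G and M = UNIV and p = 0])
      (rule oF oG oH FG HF HG cH subset_UNIV is_interval_univ UNIV_I)+
  then obtain z where z: "H z = z" by blast
  \<comment> \<open>Translating \<open>z\<close> by a multiple of \<open>2 * pi\<close> gives a
    fixed point of \<open>H\<close> at or to the left of \<open>x\<close>.\<close>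
  define m where "m = \<lfloor>(x - z) / (2 * pi)\<rfloor>"
  define a where "a = z + 2 * pi * of_int m"
  have "H a = a" using z by (simp add: a_def circle_lift_shift[OF H])
  moreover have "a \<le> x"
  proof -
    have "of_int m \<le> (x - z) / (2 * pi)" unfolding m_def by linarith
    then show ?thesis by (simp add: a_def field_simps)
  qed
  ultimately obtain u where u: "a \<le> u" "u \<le> x" "H u = u" "\<And>y. u < y \<Longrightarrow> y \<le> x \<Longrightarrow> H y \<noteq> y"
    using last_fixed_point[of a x H] cH by blast
  have ux: "u < x" using u(2,3) \<open>H x \<noteq> x\<close> by (cases "u = x") auto
  have Hu: "H (u + 2 * pi) = u + 2 * pi" using u(3) circle_lift_shift[OF H, of u 1] by simp
  have "x < u + 2 * pi"
  proof (rule ccontr)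
    assume "\<not> x < u + 2 * pi"
    then show False using u(4)[of "u + 2 * pi"] Hu by simp
  qed
  then obtain v where v: "x \<le> v" "v \<le> u + 2 * pi" "H v = v" "\<And>y. x \<le> y \<Longrightarrow> y < v \<Longrightarrow> H y \<noteq> y"
    using first_fixed_point[OF cH less_imp_le Hu, of x] by blast
  have nofix: "H y \<noteq> y" if "u < y" "y < v" for y using u(4)[of y] v(4)[of y] that by linarith
  have uv: "u < v" using ux v(1) by simp
  obtain q k where q: "q > 0" "(F ^^ q) u = u + 2 * pi * of_int k"
    using circle_lift_periodic[OF F H HF u(3) v(3) uv v(2) nofix] by blast
  obtain r l where r: "r > 0" "(G ^^ r) u = u + 2 * pi * of_int l"
    using circle_lift_periodic[OF G H HG u(3) v(3) uv v(2) nofix] by blast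
  \<comment> \<open>Translations by multiples of \<open>2 * pi\<close> commute with all lifts, so
    the commutator of \<open>?F\<close> and \<open>?G\<close> is that of \<open>F ^^ q\<close> and
    \<open>G ^^ r\<close>, namely \<open>H ^^ (q * r)\<close>.\<close>
  let ?F = "\<lambda>t. (F ^^ q) t - 2 * pi * of_int k" and ?G = "\<lambda>t. (G ^^ r) t - 2 * pi * of_int l"
      and ?H = "H ^^ (q * r)"
  have trans: "order_aut UNIV (\<lambda>t::real. t - c)" for c
    unfolding order_aut_def by (auto simp: strict_mono_on_def surj_def intro: exI[of _ "_ + c"])
  have shift: "(E ^^ n) (t - 2 * pi * of_int m) = (E ^^ n) t - 2 * pi * of_int m"
    if "circle_lift E" for E n t and m :: int
    using circle_lift_funpow_shift[OF that, of n t "- m"] by simp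
  note shifts = shift[OF F] shift[OF G] shift[OF H]
  have comm: "(H ^^ n) ((E ^^ m) t) = (E ^^ m) ((H ^^ n) t)" if "\<And>x. H (E x) = E (H x)" for E n m t
    by (rule funpow_commute_on[of UNIV]) (use that in auto)
  show False
  proof (rule germ_not_archimedean[of UNIV ?F ?G ?H u x])
    show "order_aut UNIV ?F" "order_aut UNIV ?G"
      using order_aut_compose[OF trans order_aut_funpow[OF oF]] order_aut_compose[OF trans
          order_aut_funpow[OF oG]] by auto
    show "order_aut UNIV ?H" by (rule order_aut_funpow[OF oH])
    show "?F (?G t) = ?H (?G (?F t))" for t
    proof -
      have "(F ^^ q) ((G ^^ r) t) = ?H ((G ^^ r) ((F ^^ q) t))"
        by (rule funpow_commutator_on[of UNIV]) (use FG HF HG in auto)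
      then show ?thesis by (simp add: shifts)
    qed
    show "?H (?F t) = ?F (?H t)" "?H (?G t) = ?G (?H t)" for t
      using comm[of F, OF HF] comm[of G, OF HG] by (simp_all add: shifts)
    show "?F u = u" "?G u = u" using q r by simp_all
    have "continuous_on UNIV (H ^^ n)" for n
      by (induction n) (auto simp: comp_def id_def intro: continuous_on_compose2[OF cH[of UNIV]])
    then show "continuous_on UNIV ?H" .
    show "?H y \<noteq> y" if "u < y" "y \<le> x" for y
      using order_aut_funpow_fixed[OF oH UNIV_I, of "q * r" y] u(4)[OF that] q(1) r(1) by auto
  qed (use ux in auto)
qed

text \<open>The relations pass to lifts up to constant multiples of \<open>2 * pi\<close>. Once
  these constants are removed, the lift of \<open>c\<close> is a central commutator of lifts, hence
  the identity.\<close>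

lemma Diff2_circle_central_commutator:
  assumes carr: "f \<in> carrier Diff2_circle" "g \<in> carrier Diff2_circle" "c \<in> carrier Diff2_circle"
    and fg: "f \<otimes>\<^bsub>Diff2_circle\<^esub> g = c \<otimes>\<^bsub>Diff2_circle\<^esub> (g \<otimes>\<^bsub>Diff2_circle\<^esub> f)"
    and cf: "c \<otimes>\<^bsub>Diff2_circle\<^esub> f = f \<otimes>\<^bsub>Diff2_circle\<^esub> c"
    and cg: "c \<otimes>\<^bsub>Diff2_circle\<^esub> g = g \<otimes>\<^bsub>Diff2_circle\<^esub> c"
  shows "c = \<one>\<^bsub>Diff2_circle\<^esub>"
proof -
  interpret D: group Diff2_circle by (rule Diff2_circle_group)
  have Bij: "d \<in> Bij circle" if "d \<in> carrier Diff2_circle" for d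
    using that by (simp add: Diff2_circle_def)
  have eval: "(d \<otimes>\<^bsub>Diff2_circle\<^esub> e) (cis t) = d (e (cis t))"
    if "d \<in> carrier Diff2_circle" "e \<in> carrier Diff2_circle" for d e t
    using Bij[OF that(1)] Bij[OF that(2)] by (simp add: Diff2_circle_def BijGroup_def compose_eq)
  obtain F where F: "circle_lift F" "\<And>t. f (cis t) = cis (F t)"
      by (rule circle_lift_exists[OF carr(1)]) blast
  obtain G where G: "circle_lift G" "\<And>t. g (cis t) = cis (G t)"
      by (rule circle_lift_exists[OF carr(2)]) blast
  obtain C where C: "circle_lift C" "\<And>t. c (cis t) = cis (C t)"
      by (rule circle_lift_exists[OF carr(3)]) blast
  have cont: "continuous_on UNIV (\<lambda>t. A (B t))" if "circle_lift A" "continuous_on UNIV B" for A B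
    by (rule continuous_on_compose2[OF circle_lift_continuous[OF that(1), of UNIV] that(2)]) simp
  note lcont = circle_lift_continuous
  have "f (g (cis t)) = c (g (f (cis t)))" for t
    using fun_cong[OF fg, of
        "cis t"] eval[OF carr(1,2)] eval[OF carr(3) D.m_closed[OF carr(2,1)]] eval[OF carr(2,1)]
      F(2) G(2) C(2) by (simp add: eval carr)
  then have "cis (F (G t)) = cis (C (G (F t)))" for t by (simp add: F(2) G(2) C(2))
  then obtain k :: int where k: "\<And>t. F (G t) = C (G (F t)) + 2 * pi * of_int k"
    using cis_eq_imp_const_shift[OF cont[OF F(1) lcont[OF G(1)]] cont[OF C(1) cont[OF G(1)
        lcont[OF F(1)]]]] by blast
  \<comment> \<open>Lifts are determined only up to multiples of \<open>2 * pi\<close>; this lift of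
    \<open>c\<close> absorbs \<open>k\<close>, so that \<open>F (G t) = H (G (F t))\<close> holds
    exactly.\<close>
  define H where "H t = C t + 2 * pi * of_int k" for t
  have H: "circle_lift H" unfolding H_def by (rule circle_lift_add_const[OF C(1)])
  have cH: "c (cis t) = cis (H t)" for t
    unfolding C(2) H_def by (subst cis_eq_cis_iff) (rule exI[of _ "- k"], simp)
  have comm: "H (E t) = E (H t)"
    if e: "e \<in> carrier Diff2_circle" and E: "circle_lift E" "\<And>t. e (cis t) = cis (E t)"
      and ce: "c \<otimes>\<^bsub>Diff2_circle\<^esub> e = e \<otimes>\<^bsub>Diff2_circle\<^esub> c" for e E t
  proof -
    have "cis (H (E s)) = cis (E (H s))" for s
      using fun_cong[OF ce, of "cis s"] eval[OF carr(3) e, of s] eval[OF e carr(3), of s]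
          by (simp add: E(2) cH)
    then obtain j :: int where j: "\<And>t. H (E t) = E (H t) + 2 * pi * of_int j"
      using cis_eq_imp_const_shift[OF cont[OF H lcont[OF E(1)]] cont[OF E(1) lcont[OF H]]] by blast
    \<comment> \<open>The translation by \<open>2 * pi * j\<close> is the commutator of
      \<open>H\<close> and \<open>E\<close> and commutes with both.\<close>
    have "2 * pi * real_of_int j = 0"
      by (rule translation_not_commutator[of H E])
        (fact circle_lift_order_aut[OF H] circle_lift_order_aut[OF E(1)] j circle_lift_shift[OF H]
            circle_lift_shift[OF E(1)])+
    with j show ?thesis by simp
  qed
  have "F (G t) = H (G (F t))" for t using k by (simp add: H_def)
  then have "H t = t" for t
    by (rule circle_lifts_central_commutator[OF F(1) G(1) H _ comm[OF carr(1) F cf] comm[OF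
        carr(2) G cg]])
  then have c: "c (cis t) = cis t" for t by (simp add: cH)
  have "c = (\<lambda>z\<in>circle. z)"
  proof (rule extensionalityI)
    show "c \<in> extensional circle" using Bij[OF carr(3)] by (simp add: Bij_def)
    fix z :: complex assume z: "z \<in> circle"
    then have "z = cis (Arg z)" using cis_Arg[of z] by (cases "z = 0") (auto simp: sgn_div_norm)
    with c[of "Arg z"] z show "c z = (\<lambda>z\<in>circle. z) z" by simp
  qed simp
  then show ?thesis by (simp add: Diff2_circle_def BijGroup_def)
qed

text \<open>The hypothesis \<open>central\<close> concerns the ambient group only, so one dynamical
  statement for each group settles all of its subgroups.\<close>

lemma (in group) nilpotent_subgroup_abelian:
  assumes central: "\<And>x y c. x \<in> carrier G \<Longrightarrow> y \<in> carrier G \<Longrightarrow> c \<in> carrier G \<Longrightarrow>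
      x \<otimes> y = c \<otimes> (y \<otimes> x) \<Longrightarrow> c \<otimes> x = x \<otimes> c \<Longrightarrow> c \<otimes> y = y \<otimes> c \<Longrightarrow> c = \<one>"
    and H: "subgroup H G" "nilpotent_group (G\<lparr>carrier := H\<rparr>)"
  shows "comm_group (G\<lparr>carrier := H\<rparr>)"
proof (rule ccontr)
  assume nc: "\<not> comm_group (G\<lparr>carrier := H\<rparr>)"
  interpret K: group "G\<lparr>carrier := H\<rparr>" by (rule subgroup_imp_group[OF H(1)])
  obtain x y c where "x \<in> H" "y \<in> H" "c \<in> H" "c \<noteq> \<one>"
    "x \<otimes> y = c \<otimes> (y \<otimes> x)" "c \<otimes> x = x \<otimes> c" "c \<otimes> y = y \<otimes> c"
    using K.nilpotent_noncommuting_central[OF H(2) nc] by auto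
  with central subgroup.subset[OF H(1)] show False by blast
qed

theorem theorem1p1:
  shows "(\<forall>H. subgroup H (Diff2_interval {0..1}) \<and>
              nilpotent_group ((Diff2_interval {0..1})\<lparr>carrier := H\<rparr>) \<longrightarrow>
              comm_group ((Diff2_interval {0..1})\<lparr>carrier := H\<rparr>)) \<and>
         (\<forall>H. subgroup H (Diff2_interval {0..<1}) \<and>
              nilpotent_group ((Diff2_interval {0..<1})\<lparr>carrier := H\<rparr>) \<longrightarrow>
              comm_group ((Diff2_interval {0..<1})\<lparr>carrier := H\<rparr>)) \<and>
         (\<forall>H. subgroup H Diff2_circle \<and>
              nilpotent_group (Diff2_circle\<lparr>carrier := H\<rparr>) \<longrightarrow>
              comm_group (Diff2_circle\<lparr>carrier := H\<rparr>))"
proof -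
  \<comment> \<open>Both intervals have the least element 0, which serves as the end point
    \<open>a\<close> of the interval argument.\<close>
  have interval: "comm_group ((Diff2_interval M)\<lparr>carrier := H\<rparr>)"
    if M: "is_interval M" "0 \<in> M" "\<And>x. x \<in> M \<Longrightarrow> 0 \<le> x" "\<And>x. x \<in> M \<Longrightarrow> x islimpt M"
      and H: "subgroup H (Diff2_interval M)" "nilpotent_group ((Diff2_interval M)\<lparr>carrier := H\<rparr>)"
          for M H
  proof -
    have "group (Diff2_interval M)" by (rule Diff2_interval_group) (rule M(4))
    then show ?thesis
      by (rule group.nilpotent_subgroup_abelian[OF _ _ H])
        (use Diff2_interval_central_commutator[OF M(1,2)] M(3,4) in blast)
  qed
  have circle: "comm_group (Diff2_circle\<lparr>carrier := H\<rparr>)"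
    if "subgroup H Diff2_circle" "nilpotent_group (Diff2_circle\<lparr>carrier := H\<rparr>)" for H
    by (rule group.nilpotent_subgroup_abelian[OF Diff2_circle_group
        Diff2_circle_central_commutator that])
  have "x islimpt {0..<1}" if "x \<in> {0..<1}" for x :: real
    using that by simp
  then show ?thesis
    using interval[of "{0..1}"] interval[of "{0..<1}"] circle
    by (auto simp: is_interval_cc is_interval_co)
qed

end
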